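(* Let $p>1$ (with $p=\infty$ allowed), let $C>0$, and let $(G_n)_{n\ge 0}$ be a $C$-upper $L^p$ regular sequence of weighted graphs. Then there exists an $L^p$ graphon $W$ with $\|W\|_p\le C$ such that $$\liminf_{n\to\infty}\ \delta_\square\!\left(\frac{G_n}{\|G_n\|_1},\,W\right)=0 .$$
   Context: A weighted graph $G$ is a finite graph with vertex set $V(G)$, in which each vertex $i$ has a weight $\alpha_i=\alpha_i(G)>0$ and each edge $ij$ (loops $i=j$ allowed) has a weight $\beta_{ij}=\beta_{ji}=\beta_{ij}(G)\in\mathbb{R}$, with $\beta_{ij}=0$ if $ij$ is not an edge. For $U\subseteq V(G)$ put $\alpha_U=\sum_{i\in U}\alpha_i$, and $\alpha_G=\alpha_{V(G)}$. Put $\|G\|_1=\sum_{i,j\in V(G)}\frac{\alpha_i\alpha_j}{\alpha_G^2}|\beta_{ij}|$; graphs being normalized are assumed to have $\|G\|_1\neq 0$. For $c\in\mathbb{R}$, $cG$ denotes $G$ with all edge weights multiplied by $c$ (vertex weights unchanged). For nonempty $S,T\subseteq V(G)$ let $\rho_G(S,T)=\sum_{s\in S,\,t\in T}\frac{\alpha_s\alpha_t}{\alpha_S\alpha_T}\beta_{st}$. The graph $G$ is $(C,\eta)$-upper $L^p$ regular if $\alpha_i\le\eta\alpha_G$ for all $i\in V(G)$ and, whenever $V_1\cup\dots\cup V_m$ is a partition of $V(G)$ into disjoint sets with $\alpha_{V_i}\ge\eta\alpha_G$ for each $i$, $$\sum_{i,j=1}^m\frac{\alpha_{V_i}\alpha_{V_j}}{\alpha_G^2}\left|\frac{\rho_G(V_i,V_j)}{\|G\|_1}\right|^p\le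 C^p,$$ where for $p=\infty$ this is replaced by $\max_{i,j}|\rho_G(V_i,V_j)|/\|G\|_1\le C$. A sequence $(G_n)_{n\ge0}$ is $C$-upper $L^p$ regular if for every $\eta>0$ there is $n_0(\eta)$ such that $G_n$ is $(C+\eta,\eta)$-upper $L^p$ regular for all $n\ge n_0(\eta)$. A graphon is a symmetric (Borel) measurable integrable function $W:[0,1]^2\to\mathbb{R}$; $\|W\|_p$ is the $L^p$ norm with respect to Lebesgue measure on $[0,1]^2$; an $L^p$ graphon is a graphon with $\|W\|_p<\infty$. The cut norm is $\|W\|_\square=\sup_{S,T\subseteq[0,1]\text{ measurable}}\left|\int_{S\times T}W\right|$, and $\delta_\square(W,W')=\inf_\sigma\|W^\sigma-W'\|_\square$ over measure-preserving bijections $\sigma:[0,1]\to[0,1]$, where $W^\sigma(x,y)=W(\sigma(x),\sigma(y))$. The graphon $W^G$ of a weighted graph $G$: divide $[0,1]$ into consecutive intervals $I_i$ of length $\alpha_i/\alpha_G$ ($i\in V(G)$) and let $W^G=\beta_{ij}$ on $I_i\times I_j$. Finally $\delta_\square(G,W):=\delta_\square(W^G,W)$. *)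

theory Defs
  imports "HOL-Probability.Essential_Supremum"
begin

text \<open>
  Vertex types are linearly ordered so that ``consecutive intervals'' in the graphon of a graph
  makes sense. Edges are sets \<open>{i, j}\<close>; the loop at \<open>i\<close> is \<open>{i}\<close>.
\<close>

record 'v wgraph =
  verts :: "'v set"
  edges :: "'v set set"
  vweight :: "'v \<Rightarrow> real"
  eweight :: "'v \<Rightarrow> 'v \<Rightarrow> real"

definition weighted_graph :: "'v wgraph \<Rightarrow> bool" where
  "weighted_graph G \<longleftrightarrow>
     finite (verts G) \<and> verts G \<noteq> {} \<and>
     edges G \<subseteq> {{i, j} |i j. i \<in> verts G \<and> j \<in> verts G} \<and>
     (\<forall>i\<in>verts G. vweight G i > 0) \<and>
     (\<forall>i\<in>verts G. \<forall>j\<in>verts G. eweight G i j = eweight G j i) \<and>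
     (\<forall>i\<in>verts G. \<forall>j\<in>verts G. {i, j} \<notin> edges G \<longrightarrow> eweight G i j = 0)"

definition set_weight :: "'v wgraph \<Rightarrow> 'v set \<Rightarrow> real" where
  "set_weight G U = (\<Sum>i\<in>U. vweight G i)"

definition total_weight :: "'v wgraph \<Rightarrow> real" where
  "total_weight G = set_weight G (verts G)"

definition norm1 :: "'v wgraph \<Rightarrow> real" where
  "norm1 G = (\<Sum>i\<in>verts G. \<Sum>j\<in>verts G.
     vweight G i * vweight G j / (total_weight G)\<^sup>2 * \<bar>eweight G i j\<bar>)"

definition scale_graph :: "real \<Rightarrow> 'v wgraph \<Rightarrow> 'v wgraph" where
  "scale_graph c G = G\<lparr>eweight := \<lambda>i j. c * eweight G i j\<rparr>"

definition edge_density :: "'v wgraph \<Rightarrow> 'v set \<Rightarrow> 'v set \<Rightarrow> real" where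
  "edge_density G S T = (\<Sum>s\<in>S. \<Sum>t\<in>T.
     vweight G s * vweight G t / (set_weight G S * set_weight G T) * eweight G s t)"

definition upper_Lp_regular :: "real \<Rightarrow> real \<Rightarrow> ereal \<Rightarrow> 'v wgraph \<Rightarrow> bool" where
  "upper_Lp_regular C \<eta> p G \<longleftrightarrow>
     (\<forall>i\<in>verts G. vweight G i \<le> \<eta> * total_weight G) \<and>
     (\<forall>P. partition_on (verts G) P \<and> (\<forall>U\<in>P. set_weight G U \<ge> \<eta> * total_weight G) \<longrightarrow>
        (if p = \<infinity>
         then Max ((\<lambda>(U, V). \<bar>edge_density G U V\<bar> / norm1 G) ` (P \<times> P)) \<le> C
         else (\<Sum>U\<in>P. \<Sum>V\<in>P. set_weight G U * set_weight G V / (total_weight G)\<^sup>2 *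
                 \<bar>edge_density G U V / norm1 G\<bar> powr real_of_ereal p)
              \<le> C powr real_of_ereal p))"

definition upper_Lp_regular_seq :: "real \<Rightarrow> ereal \<Rightarrow> (nat \<Rightarrow> 'v wgraph) \<Rightarrow> bool" where
  "upper_Lp_regular_seq C p G \<longleftrightarrow>
     (\<forall>\<eta>>0. \<exists>n0. \<forall>n\<ge>n0. upper_Lp_regular (C + \<eta>) \<eta> p (G n))"

text \<open>
  Graphons are total functions of which only the values on the unit square matter.
  Integrability over the unit square with respect to \<open>lborel\<close> includes Borel measurability there.
\<close>

abbreviation unit_square :: "(real \<times> real) set" where
  "unit_square \<equiv> {0..1} \<times> {0..1}"

definition graphon :: "(real \<times> real \<Rightarrow> real) \<Rightarrow> bool" where
  "graphon W \<longleftrightarrow>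
     set_integrable lborel unit_square W \<and>
     (\<forall>x\<in>{0..1}. \<forall>y\<in>{0..1}. W (x, y) = W (y, x))"

definition Lp_norm :: "ereal \<Rightarrow> (real \<times> real \<Rightarrow> real) \<Rightarrow> ereal" where
  "Lp_norm p W =
     (if p = \<infinity> then esssup (restrict_space lborel unit_square) (\<lambda>z. ereal \<bar>W z\<bar>)
      else let I = (\<integral>\<^sup>+z\<in>unit_square. ennreal (\<bar>W z\<bar> powr real_of_ereal p) \<partial>lborel)
           in if I = \<infinity> then \<infinity> else ereal (enn2real I powr (1 / real_of_ereal p)))"

definition Lp_graphon :: "ereal \<Rightarrow> (real \<times> real \<Rightarrow> real) \<Rightarrow> bool" where
  "Lp_graphon p W \<longleftrightarrow> graphon W \<and> Lp_norm p W < \<infinity>"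

definition cut_norm :: "(real \<times> real \<Rightarrow> real) \<Rightarrow> ereal" where
  "cut_norm W =
     (SUP (S, T) \<in> {S. S \<in> sets borel \<and> S \<subseteq> {0..1}} \<times> {T. T \<in> sets borel \<and> T \<subseteq> {0..1}}.
        ereal \<bar>LINT z:S \<times> T|lborel. W z\<bar>)"

abbreviation unit_interval :: "real measure" where
  "unit_interval \<equiv> restrict_space lborel {0..1}"

definition measure_preserving_bij :: "(real \<Rightarrow> real) \<Rightarrow> bool" where
  "measure_preserving_bij \<sigma> \<longleftrightarrow>
     bij_betw \<sigma> {0..1} {0..1} \<and>
     \<sigma> \<in> measurable unit_interval unit_interval \<and>
     distr unit_interval unit_interval \<sigma> = unit_interval"

definition rearrange :: "(real \<Rightarrow> real) \<Rightarrow> (real \<times> real \<Rightarrow> real) \<Rightarrow> real \<times> real \<Rightarrow> real" where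
  "rearrange \<sigma> W = (\<lambda>(x, y). W (\<sigma> x, \<sigma> y))"

definition cut_dist :: "(real \<times> real \<Rightarrow> real) \<Rightarrow> (real \<times> real \<Rightarrow> real) \<Rightarrow> ereal" where
  "cut_dist W W' =
     (INF \<sigma> \<in> {\<sigma>. measure_preserving_bij \<sigma>}. cut_norm (\<lambda>z. rearrange \<sigma> W z - W' z))"

text \<open>
  The intervals are half-open, so they cover \<open>[0,1)\<close>; the graphon of a graph is \<open>0\<close> on the
  null set of points of the square with a coordinate equal to \<open>1\<close>.
\<close>

definition vertex_interval :: "'v::linorder wgraph \<Rightarrow> 'v \<Rightarrow> real set" where
  "vertex_interval G i =
     {set_weight G {j \<in> verts G. j < i} / total_weight G ..<
      set_weight G {j \<in> verts G. j \<le> i} / total_weight G}"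

definition graphon_of :: "'v::linorder wgraph \<Rightarrow> real \<times> real \<Rightarrow> real" where
  "graphon_of G = (\<lambda>(x, y). \<Sum>i\<in>verts G. \<Sum>j\<in>verts G.
     eweight G i j * indicator (vertex_interval G i) x * indicator (vertex_interval G j) y)"

definition graph_cut_dist :: "'v::linorder wgraph \<Rightarrow> (real \<times> real \<Rightarrow> real) \<Rightarrow> ereal" where
  "graph_cut_dist G W = cut_dist (graphon_of G) W"

end

theory Submission
  imports Defs "HOL-Library.Diagonal_Subsequence"
begin

text \<open>
  Each graph \<open>G n\<close> gets a chain of vertex labellings, level \<open>k\<close> having \<open>4 ^ k\<close> blocks of relative
  weight at least \<open>1 / 16 ^ k\<close>. The two sets splitting level \<open>k\<close> are essentially a worst pair for the
  cut discrepancy between the graph and its block average \<open>U n k\<close>, so that this discrepancy is at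
  most \<open>36 * \<parallel>U n (Suc k) - U n k\<parallel>\<^sub>1\<close>; no explicit regularity lemma is needed. Passing to a
  subsequence, the block boundaries, block averages and energies \<open>\<integral> sqrt (1 + (U n k)\<^sup>2)\<close> converge,
  hence \<open>U n k\<close> converges in \<open>L\<^sup>1\<close> for every \<open>k\<close>. The energies are bounded and increase with \<open>k\<close>, and by
  the uniform integrability coming from the \<open>L\<^sup>p\<close> bound an energy gap controls the \<open>L\<^sup>1\<close> distance.
  Therefore the limits are Cauchy in \<open>k\<close>, and a diagonal sequence of block averages converges in
  \<open>L\<^sup>1\<close> to the required graphon, while its distance to the graphs tends to \<open>0\<close> in cut norm.
\<close>

section \<open>Refining block partitions\<close>

text \<open>The hypothesis is silent about sets of small weight: it bounds block averages only for
  partitions into parts of relative weight at least \<open>\<eta>\<close>. A pair of sets with large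
  discrepancy may cut mere slivers off some blocks, so it is first traded, at the cost of a constant
  factor, for a pair that splits every block into sizeable parts. Hence the numbers: two sets split
  a block into \<open>4\<close>, and each split divides the guaranteed weight by \<open>4\<close>,
  which makes \<open>16\<close> per level. The same lower bound on the weights bounds the averages
  of level \<open>k\<close> by a number depending on \<open>k\<close> only, and this gives
  compactness at each fixed level. That number grows with \<open>k\<close>, and the second moment of
  the classical energy argument may be unbounded for \<open>p < 2\<close>; an energy of linear
  growth takes its place. As the claim is about a liminf, a subsequence suffices: for each
  \<open>n\<close> a graph regular enough for \<open>n\<close> levels is picked, and limits are
  taken over graphs first and over levels second.\<close>

lemma subset_weight_between:
  fixes w :: "'v \<Rightarrow> real"
  assumes "finite U" "\<And>i. i \<in> U \<Longrightarrow> 0 \<le> w i \<and> w i \<le> \<tau>" "0 \<le> t" "t \<le> sum w U" "0 \<le> \<tau>"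
  shows "\<exists>A\<subseteq>U. t \<le> sum w A \<and> sum w A \<le> t + \<tau>"
  using assms
proof (induction U rule: finite_induct)
  case empty
  then show ?case by auto
next
  case (insert x U)
  show ?case
  proof (cases "t \<le> sum w U")
    case True
    then obtain A where "A \<subseteq> U" "t \<le> sum w A \<and> sum w A \<le> t + \<tau>"
      using insert by auto
    then show ?thesis by blast
  next
    case False
    have "sum w (insert x U) \<le> t + \<tau>"
      using False insert(1,2) insert(4)[of x] by simp
    then show ?thesis using insert by blast
  qed
qed

text \<open>Two successive greedy choices weigh between \<open>\<eta> / 4\<close> and
  \<open>3 * \<eta> / 8\<close> each, since a single element overshoots by at most
  \<open>\<eta> / 8\<close>. What is left still weighs at least \<open>\<eta> / 4\<close>.\<close>

lemma split_into_thirds: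
  fixes w :: "'v \<Rightarrow> real"
  assumes fin: "finite U" and w: "\<And>i. i \<in> U \<Longrightarrow> 0 \<le> w i \<and> w i \<le> \<eta> / 8"
    and \<eta>: "0 \<le> \<eta>" "\<eta> \<le> sum w U"
  shows "\<exists>h. \<forall>c<3::nat. \<eta> / 4 \<le> (\<Sum>i\<in>{i \<in> U. h i = c}. w i)"
proof -
  obtain A where A: "A \<subseteq> U" "\<eta> / 4 \<le> sum w A" "sum w A \<le> \<eta> / 4 + \<eta> / 8"
    using subset_weight_between[of U w "\<eta> / 8" "\<eta> / 4"] assms by auto
  have dA: "sum w (U - A) = sum w U - sum w A"
    using A fin by (simp add: sum_diff)
  obtain B where B: "B \<subseteq> U - A" "\<eta> / 4 \<le> sum w B" "sum w B \<le> \<eta> / 4 + \<eta> / 8"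
    using subset_weight_between[of "U - A" w "\<eta> / 8" "\<eta> / 4"] assms A dA by auto
  have dB: "sum w (U - A - B) = sum w U - sum w A - sum w B"
    using B fin dA by (simp add: sum_diff)
  define h where "h i = (if i \<in> A then 0 else if i \<in> B then 1 else 2 :: nat)" for i
  have "{i \<in> U. h i = 0} = A" "{i \<in> U. h i = 1} = B" "{i \<in> U. h i = 2} = U - A - B"
    using A(1) B(1) by (auto simp: h_def)
  moreover have "\<eta> / 4 \<le> sum w (U - A - B)" using dB A B \<eta> by simp
  ultimately have "\<eta> / 4 \<le> (\<Sum>i\<in>{i \<in> U. h i = c}. w i)" if "c < 3" for c
  proof -
    have "c = 0 \<or> c = 1 \<or> c = 2" using that by auto
    then show ?thesis
      using \<open>{i \<in> U. h i = 0} = A\<close> \<open>{i \<in> U. h i = 1} = B\<close> \<open>{i \<in> U. h i = 2} = U - A - B\<close>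
        \<open>\<eta> / 4 \<le> sum w (U - A - B)\<close> A B by auto
  qed
  then show ?thesis by blast
qed

text \<open>
  With each block cut into large parts \<open>H 0\<close>, \<open>H 1\<close>, \<open>H 2\<close>, one of the \<open>S \<inter> H u\<close> carries a third of the
  sum, and \<open>S \<inter> H u\<close> is the difference of \<open>(S \<inter> H u) \<union> H v\<close> and \<open>H v\<close>, both of which contain \<open>H v\<close>
  and avoid the remaining part. This circumvents any estimate for sets of small weight, which
  would not be available for the edge weights.
\<close>

lemma balanced_subset:
  fixes w c :: "'v \<Rightarrow> real" and \<kappa> :: "'v \<Rightarrow> nat"
  assumes fin: "finite V" and w: "\<And>i. i \<in> V \<Longrightarrow> 0 \<le> w i \<and> w i \<le> \<eta> / 8" and \<eta>: "0 \<le> \<eta>"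
    and classes: "\<And>a. a < m \<Longrightarrow> \<eta> \<le> (\<Sum>i\<in>{i \<in> V. \<kappa> i = a}. w i)"
    and S: "S \<subseteq> V"
  shows "\<exists>S'\<subseteq>V. \<bar>sum c S\<bar> \<le> 6 * \<bar>sum c S'\<bar> \<and>
    (\<forall>a<m. \<eta> / 4 \<le> (\<Sum>i\<in>{i \<in> V. \<kappa> i = a \<and> i \<in> S'}. w i) \<and>
           \<eta> / 4 \<le> (\<Sum>i\<in>{i \<in> V. \<kappa> i = a \<and> i \<notin> S'}. w i))"
proof -
  have "\<forall>a. \<exists>h. a < m \<longrightarrow> (\<forall>c<3::nat. \<eta> / 4 \<le> (\<Sum>i\<in>{i \<in> {i \<in> V. \<kappa> i = a}. h i = c}. w i))"
  proof
    fix a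
    show "\<exists>h. a < m \<longrightarrow> (\<forall>c<3::nat. \<eta> / 4 \<le> (\<Sum>i\<in>{i \<in> {i \<in> V. \<kappa> i = a}. h i = c}. w i))"
      using split_into_thirds[of "{i \<in> V. \<kappa> i = a}" w \<eta>] fin w \<eta> classes[of a] by auto
  qed
  from choice[OF this] obtain h0
    where h0: "\<And>a c. a < m \<Longrightarrow> c < (3::nat) \<Longrightarrow>
      \<eta> / 4 \<le> (\<Sum>i\<in>{i \<in> {i \<in> V. \<kappa> i = a}. h0 a i = c}. w i)"
    by blast
  define h where "h i = h0 (\<kappa> i) i" for i
  define H where "H c = {i \<in> V. h i = c}" for c
  have H: "\<eta> / 4 \<le> sum w {i \<in> V. \<kappa> i = a \<and> i \<in> H c}" if "a < m" "c < 3" for a c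
  proof -
    have "{i \<in> V. \<kappa> i = a \<and> i \<in> H c} = {i \<in> {i \<in> V. \<kappa> i = a}. h0 a i = c}"
      by (auto simp: H_def h_def)
    then show ?thesis using h0[OF that] by simp
  qed
  have mono: "sum w A \<le> sum w B" if "A \<subseteq> B" "B \<subseteq> V" for A B
    using that fin w by (intro sum_mono2) (auto intro: finite_subset)
  have finS: "finite S" using S fin finite_subset by blast
  \<comment> \<open>Only three colours are guaranteed, so all colours other than 1 and 2 are merged into 0.\<close>
  define X where "X c = (if c = 0 then {i \<in> S. h i \<noteq> 1 \<and> h i \<noteq> 2} else {i \<in> S. h i = c})" for c :: nat
  have "S = X 0 \<union> X 1 \<union> X 2" by (auto simp: X_def)
  then have "sum c S = sum c (X 0 \<union> X 1 \<union> X 2)" by simp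
  also have "\<dots> = sum c (X 0) + sum c (X 1) + sum c (X 2)"
    using finS by (subst sum.union_disjoint; (auto simp: X_def)?)+
  finally have 1: "sum c S = sum c (X 0) + sum c (X 1) + sum c (X 2)" .
  obtain u where u: "u < 3" "\<bar>sum c S\<bar> \<le> 3 * \<bar>sum c (X u)\<bar>"
  proof -
    have "\<bar>sum c S\<bar> \<le> 3 * \<bar>sum c (X 0)\<bar> \<or> \<bar>sum c S\<bar> \<le> 3 * \<bar>sum c (X 1)\<bar> \<or>
      \<bar>sum c S\<bar> \<le> 3 * \<bar>sum c (X 2)\<bar>" using 1 by linarith
    then show ?thesis using that[of 0] that[of 1] that[of 2] by auto
  qed
  obtain v t where vt: "v < 3" "t < 3" "v \<noteq> u" "t \<noteq> u" "v \<noteq> t" "v \<noteq> 0"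
  proof (cases "u = 1")
    case True then show ?thesis using that[of 2 0] by simp
  next
    case False
    show ?thesis
    proof (cases "u = 0")
      case True then show ?thesis using that[of 1 2] by simp
    next
      case False
      with \<open>u \<noteq> 1\<close> u have "u = 2" by simp
      then show ?thesis using that[of 1 0] by simp
    qed
  qed
  have XH: "X u \<inter> H v = {}" "X u \<inter> H t = {}"
    using vt u by (auto simp: X_def H_def split: if_splits)
  have finX: "finite (X u)" "X u \<subseteq> V" using finS S by (auto simp: X_def)
  have finH: "finite (H v)" "H v \<subseteq> V" using fin by (auto simp: H_def)
  have disj: "H v \<inter> H t = {}" using vt by (auto simp: H_def)
  have "sum c (X u) = sum c (X u \<union> H v) - sum c (H v)"
    using sum.union_disjoint[OF finX(1) finH(1) XH(1), of c] by simp
  \<comment> \<open>One of two numbers has at least half the absolute value of their difference.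
    With the factor \<open>3\<close> lost in choosing \<open>u\<close> this makes
    \<open>6\<close>.\<close>
  then obtain S' where S': "S' = X u \<union> H v \<or> S' = H v" "\<bar>sum c (X u)\<bar> \<le> 2 * \<bar>sum c S'\<bar>"
  proof -
    assume *: "sum c (X u) = sum c (X u \<union> H v) - sum c (H v)" and
      **: "\<And>S'. S' = X u \<union> H v \<or> S' = H v \<Longrightarrow> \<bar>sum c (X u)\<bar> \<le> 2 * \<bar>sum c S'\<bar> \<Longrightarrow> thesis"
    show thesis
    proof (cases "\<bar>sum c (X u)\<bar> \<le> 2 * \<bar>sum c (H v)\<bar>")
      case True then show thesis using ** by blast
    next
      case False
      then have "\<bar>sum c (X u)\<bar> \<le> 2 * \<bar>sum c (X u \<union> H v)\<bar>" using * by linarith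
      then show thesis using ** by blast
    qed
  qed
  have sub: "H v \<subseteq> S'" "S' \<inter> H t = {}" "S' \<subseteq> V" using S' XH disj finX finH by auto
  show ?thesis
  proof (intro exI[of _ S'] conjI allI impI)
    show "S' \<subseteq> V" by fact
    show "\<bar>sum c S\<bar> \<le> 6 * \<bar>sum c S'\<bar>" using u S' by linarith
  next
    fix a assume a: "a < m"
    show "\<eta> / 4 \<le> (\<Sum>i\<in>{i \<in> V. \<kappa> i = a \<and> i \<in> S'}. w i)"
      by (rule order_trans[OF H[OF a vt(1)] mono]) (use sub in auto)
    show "\<eta> / 4 \<le> (\<Sum>i\<in>{i \<in> V. \<kappa> i = a \<and> i \<notin> S'}. w i)"
      by (rule order_trans[OF H[OF a vt(2)] mono]) (use sub in auto)
  qed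
qed

section \<open>Normalised finite kernels and their block averages\<close>

locale kernel =
  fixes V :: "'v set" and w :: "'v \<Rightarrow> real" and \<beta> :: "'v \<Rightarrow> 'v \<Rightarrow> real"
  assumes finite_V: "finite V" and w_pos: "\<And>i. i \<in> V \<Longrightarrow> 0 < w i" and sum_w: "sum w V = 1"
    and \<beta>_sym: "\<And>i j. i \<in> V \<Longrightarrow> j \<in> V \<Longrightarrow> \<beta> i j = \<beta> j i"
    and \<beta>_norm: "(\<Sum>i\<in>V. \<Sum>j\<in>V. w i * w j * \<bar>\<beta> i j\<bar>) \<le> 1"
begin

text \<open>The expectation of \<open>F\<close> at two independent random vertices with distribution
  \<open>w\<close>. It later becomes the integral of a step function.\<close>

definition mean :: "('v \<Rightarrow> 'v \<Rightarrow> real) \<Rightarrow> real" where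
  "mean F = (\<Sum>i\<in>V. \<Sum>j\<in>V. w i * w j * F i j)"

definition block :: "('v \<Rightarrow> nat) \<Rightarrow> nat \<Rightarrow> 'v set" where
  "block \<kappa> a = {i \<in> V. \<kappa> i = a}"

definition mass :: "('v \<Rightarrow> nat) \<Rightarrow> nat \<Rightarrow> nat \<Rightarrow> real" where
  "mass \<kappa> a b = (\<Sum>i\<in>block \<kappa> a. \<Sum>j\<in>block \<kappa> b. w i * w j * \<beta> i j)"

text \<open>Indexed by labels instead of vertices, so that the averages of different graphs can be
  compared and have limits.\<close>

definition avg :: "('v \<Rightarrow> nat) \<Rightarrow> nat \<Rightarrow> nat \<Rightarrow> real" where
  "avg \<kappa> a b = mass \<kappa> a b / (sum w (block \<kappa> a) * sum w (block \<kappa> b))"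

abbreviation av :: "('v \<Rightarrow> nat) \<Rightarrow> 'v \<Rightarrow> 'v \<Rightarrow> real" where
  "av \<kappa> i j \<equiv> avg \<kappa> (\<kappa> i) (\<kappa> j)"

lemma mean_add: "mean (\<lambda>i j. F i j + F' i j) = mean F + mean F'"
  by (simp add: mean_def distrib_left sum.distrib)

lemma mean_diff: "mean (\<lambda>i j. F i j - F' i j) = mean F - mean F'"
  by (simp add: mean_def right_diff_distrib sum_subtractf)

lemma mean_cmult: "mean (\<lambda>i j. c * F i j) = c * mean F"
  by (simp add: mean_def sum_distrib_left mult_ac)

lemma mean_const: "mean (\<lambda>i j. c) = c"
proof -
  have "mean (\<lambda>i j. c) = (\<Sum>i\<in>V. w i * (c * sum w V))"
    by (simp add: mean_def sum_distrib_left mult_ac)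
  then show ?thesis using sum_w by (simp add: sum_distrib_right[symmetric])
qed

lemma mean_mono: "(\<And>i j. i \<in> V \<Longrightarrow> j \<in> V \<Longrightarrow> F i j \<le> F' i j) \<Longrightarrow> mean F \<le> mean F'"
  unfolding mean_def by (intro sum_mono mult_left_mono) (auto intro!: mult_nonneg_nonneg less_imp_le[OF w_pos])

lemma mean_cong: "(\<And>i j. i \<in> V \<Longrightarrow> j \<in> V \<Longrightarrow> F i j = F' i j) \<Longrightarrow> mean F = mean F'"
  unfolding mean_def by (intro sum.cong) auto

lemma finite_block: "finite (block \<kappa> a)"
  using finite_V by (simp add: block_def)

lemma block_pos: "i \<in> V \<Longrightarrow> 0 < sum w (block \<kappa> (\<kappa> i))"
  by (rule sum_pos2[OF finite_block, of i]) (auto simp: block_def intro: less_imp_le w_pos)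

lemma mean_blocks:
  "mean F = (\<Sum>a\<in>\<kappa> ` V. \<Sum>b\<in>\<kappa> ` V. \<Sum>i\<in>block \<kappa> a. \<Sum>j\<in>block \<kappa> b. w i * w j * F i j)"
proof -
  have "mean F = (\<Sum>a\<in>\<kappa> ` V. \<Sum>i\<in>block \<kappa> a. \<Sum>j\<in>V. w i * w j * F i j)"
    unfolding mean_def block_def by (rule sum.group[symmetric]) (use finite_V in auto)
  also have "\<dots> = (\<Sum>a\<in>\<kappa> ` V. \<Sum>i\<in>block \<kappa> a. \<Sum>b\<in>\<kappa> ` V. \<Sum>j\<in>block \<kappa> b. w i * w j * F i j)"
    unfolding block_def by (intro sum.cong refl sum.group[symmetric]) (use finite_V in auto)
  also have "\<dots> = (\<Sum>a\<in>\<kappa> ` V. \<Sum>b\<in>\<kappa> ` V. \<Sum>i\<in>block \<kappa> a. \<Sum>j\<in>block \<kappa> b. w i * w j * F i j)"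
    by (intro sum.cong refl sum.swap)
  finally show ?thesis .
qed

lemma mean_label:
  "mean (\<lambda>i j. H (\<kappa> i) (\<kappa> j)) =
    (\<Sum>a\<in>\<kappa> ` V. \<Sum>b\<in>\<kappa> ` V. sum w (block \<kappa> a) * sum w (block \<kappa> b) * H a b)"
  unfolding mean_blocks[of _ \<kappa>] sum_product
  unfolding sum_distrib_right
  by (intro sum.cong refl) (simp add: block_def)

text \<open>\<open>av \<kappa>\<close> is the conditional expectation of \<open>\<beta>\<close>
  given both labels, so a test function of the labels cannot tell them apart. A label that occurs
  has a block of positive weight, which may be divided by.\<close>

lemma mean_avg:
  "mean (\<lambda>i j. H (\<kappa> i) (\<kappa> j) * av \<kappa> i j) = mean (\<lambda>i j. H (\<kappa> i) (\<kappa> j) * \<beta> i j)"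
proof -
  have "mean (\<lambda>i j. H (\<kappa> i) (\<kappa> j) * \<beta> i j) = (\<Sum>a\<in>\<kappa> ` V. \<Sum>b\<in>\<kappa> ` V. H a b * mass \<kappa> a b)"
    unfolding mean_blocks[of _ \<kappa>]
    by (intro sum.cong refl) (simp add: block_def mass_def sum_distrib_left mult_ac)
  also have "\<dots> = (\<Sum>a\<in>\<kappa> ` V. \<Sum>b\<in>\<kappa> ` V.
      sum w (block \<kappa> a) * sum w (block \<kappa> b) * (H a b * avg \<kappa> a b))"
  proof (intro sum.cong refl)
    fix a b assume "a \<in> \<kappa> ` V" "b \<in> \<kappa> ` V"
    then have "sum w (block \<kappa> a) \<noteq> 0" "sum w (block \<kappa> b) \<noteq> 0"
      using block_pos[of _ \<kappa>] by (auto simp: less_imp_neq[symmetric])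
    then show "H a b * mass \<kappa> a b = sum w (block \<kappa> a) * sum w (block \<kappa> b) * (H a b * avg \<kappa> a b)"
      by (simp add: avg_def)
  qed
  also have "\<dots> = mean (\<lambda>i j. H (\<kappa> i) (\<kappa> j) * av \<kappa> i j)"
    by (rule mean_label[symmetric])
  finally show ?thesis by simp
qed

text \<open>Conditional expectation contracts the L1 norm: the sign of the average is itself a
  function of the labels and can serve as test function.\<close>

lemma mean_abs_avg: "mean (\<lambda>i j. \<bar>av \<kappa> i j\<bar>) \<le> 1"
proof -
  have "mean (\<lambda>i j. \<bar>av \<kappa> i j\<bar>) = mean (\<lambda>i j. sgn (av \<kappa> i j) * av \<kappa> i j)"
    by (intro mean_cong) (simp add: abs_sgn mult.commute)
  also have "\<dots> = mean (\<lambda>i j. sgn (av \<kappa> i j) * \<beta> i j)"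
    by (rule mean_avg[where H = "\<lambda>a b. sgn (avg \<kappa> a b)"])
  also have "\<dots> \<le> mean (\<lambda>i j. \<bar>\<beta> i j\<bar>)"
    by (intro mean_mono) (auto simp: sgn_real_def)
  also have "\<dots> \<le> 1" using \<beta>_norm by (simp add: mean_def)
  finally show ?thesis .
qed

lemma avg_sym: "avg \<kappa> a b = avg \<kappa> b a"
proof -
  have "mass \<kappa> a b = (\<Sum>j\<in>block \<kappa> b. \<Sum>i\<in>block \<kappa> a. w i * w j * \<beta> i j)"
    unfolding mass_def by (rule sum.swap)
  also have "\<dots> = mass \<kappa> b a"
    unfolding mass_def by (intro sum.cong refl) (auto simp: block_def \<beta>_sym)
  finally show ?thesis by (simp add: avg_def mult.commute)
qed

text \<open>No block pair carries more than the whole L1 norm. The bound is crude but independent of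
  the graph, which is what dominated convergence at a fixed level calls for.\<close>

lemma abs_avg_le:
  assumes "0 < \<eta>" "\<eta> \<le> sum w (block \<kappa> a)" "\<eta> \<le> sum w (block \<kappa> b)"
  shows "\<bar>avg \<kappa> a b\<bar> \<le> 1 / \<eta>\<^sup>2"
proof -
  have "\<bar>mass \<kappa> a b\<bar> \<le> (\<Sum>i\<in>block \<kappa> a. \<Sum>j\<in>block \<kappa> b. w i * w j * \<bar>\<beta> i j\<bar>)"
    unfolding mass_def
    by (intro order_trans[OF sum_abs] sum_mono)
      (auto simp: abs_mult block_def abs_of_pos w_pos)
  also have "\<dots> \<le> (\<Sum>i\<in>V. \<Sum>j\<in>block \<kappa> b. w i * w j * \<bar>\<beta> i j\<bar>)"
    by (intro sum_mono2 finite_V sum_nonneg) (auto simp: block_def less_imp_le[OF w_pos])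
  also have "\<dots> \<le> (\<Sum>i\<in>V. \<Sum>j\<in>V. w i * w j * \<bar>\<beta> i j\<bar>)"
    by (intro sum_mono sum_mono2 finite_V) (auto simp: block_def less_imp_le[OF w_pos])
  also have "\<dots> \<le> 1" by (rule \<beta>_norm)
  finally have "\<bar>mass \<kappa> a b\<bar> \<le> 1" .
  moreover have "\<eta>\<^sup>2 \<le> sum w (block \<kappa> a) * sum w (block \<kappa> b)"
    unfolding power2_eq_square using assms by (intro mult_mono) auto
  ultimately show ?thesis
    using assms unfolding avg_def abs_divide
    by (intro frac_le) (auto simp: abs_mult)
qed

text \<open>
  The new blocks come from balancing a pair \<open>S, T\<close> of maximal discrepancy; the two applications of
  \<open>balanced_subset\<close> lose a factor \<open>6\<close> each.
\<close>

lemma refine_once: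
  assumes \<kappa>: "\<And>i. i \<in> V \<Longrightarrow> \<kappa> i < m" and \<eta>: "0 < \<eta>"
    and blocks: "\<And>a. a < m \<Longrightarrow> \<eta> \<le> sum w (block \<kappa> a)"
    and small: "\<And>i. i \<in> V \<Longrightarrow> w i \<le> \<eta> / 32"
  shows "\<exists>\<kappa>'. (\<forall>i\<in>V. \<kappa>' i div 4 = \<kappa> i) \<and> (\<forall>a<4 * m. \<eta> / 16 \<le> sum w (block \<kappa>' a)) \<and>
    (\<forall>S\<subseteq>V. \<forall>T\<subseteq>V. \<bar>\<Sum>i\<in>S. \<Sum>j\<in>T. w i * w j * (\<beta> i j - av \<kappa> i j)\<bar>
       \<le> 36 * mean (\<lambda>i j. \<bar>av \<kappa>' i j - av \<kappa> i j\<bar>))"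
proof -
  define g where "g S T = (\<Sum>i\<in>S. \<Sum>j\<in>T. w i * w j * (\<beta> i j - av \<kappa> i j))" for S T
  let ?X = "(\<lambda>(S, T). \<bar>g S T\<bar>) ` (Pow V \<times> Pow V)"
  have fX: "finite ?X" using finite_V by simp
  have "?X \<noteq> {}" by auto
  then have "Max ?X \<in> ?X" using fX by (rule Max_in[rotated])
  then obtain S T where ST: "S \<subseteq> V" "T \<subseteq> V" "Max ?X = \<bar>g S T\<bar>" by auto
  have max: "\<bar>g S' T'\<bar> \<le> \<bar>g S T\<bar>" if "S' \<subseteq> V" "T' \<subseteq> V" for S' T'
    unfolding ST(3)[symmetric] using that by (intro Max_ge fX) auto
  \<comment> \<open>The second balancing works on blocks of guaranteed weight
    \<open>\<eta> / 4\<close> only; this is where \<open>\<eta> / 32\<close> comes from.\<close>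
  have small': "0 \<le> w i \<and> w i \<le> \<eta> / 8" "0 \<le> w i \<and> w i \<le> (\<eta> / 4) / 8" if "i \<in> V" for i
    using small[OF that] w_pos[OF that] \<eta> by auto
  obtain S' where S': "S' \<subseteq> V"
      "\<bar>\<Sum>i\<in>S. \<Sum>j\<in>T. w i * w j * (\<beta> i j - av \<kappa> i j)\<bar> \<le>
        6 * \<bar>\<Sum>i\<in>S'. \<Sum>j\<in>T. w i * w j * (\<beta> i j - av \<kappa> i j)\<bar>"
      "\<And>a. a < m \<Longrightarrow> \<eta> / 4 \<le> (\<Sum>i\<in>{i \<in> V. \<kappa> i = a \<and> i \<in> S'}. w i)"
      "\<And>a. a < m \<Longrightarrow> \<eta> / 4 \<le> (\<Sum>i\<in>{i \<in> V. \<kappa> i = a \<and> i \<notin> S'}. w i)"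
    using balanced_subset[where w = w, OF finite_V small'(1), where \<kappa> = \<kappa> and m = m and S = S
       and c = "\<lambda>i. \<Sum>j\<in>T. w i * w j * (\<beta> i j - av \<kappa> i j)"] \<eta> blocks ST(1)
    unfolding block_def by auto
  \<comment> \<open>Membership in \<open>S'\<close>, and below in \<open>T'\<close>, is appended as
    a binary digit. The old label is then the new one \<open>div 4\<close>, and the last two digits
    recover both sets.\<close>
  define \<kappa>1 where "\<kappa>1 i = 2 * \<kappa> i + (if i \<in> S' then 1 else 0)" for i
  have cl1: "\<eta> / 4 \<le> (\<Sum>i\<in>{i \<in> V. \<kappa>1 i = a}. w i)" if "a < 2 * m" for a
  proof (cases "even a")
    case True
    then obtain b where "a = 2 * b" by blast
    moreover have "{i \<in> V. \<kappa>1 i = 2 * b} = {i \<in> V. \<kappa> i = b \<and> i \<notin> S'}"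
      by (auto simp: \<kappa>1_def) presburger+
    ultimately show ?thesis using S'(4)[of b] that by simp
  next
    case False
    then obtain b where "a = 2 * b + 1" by (meson oddE)
    moreover have "{i \<in> V. \<kappa>1 i = 2 * b + 1} = {i \<in> V. \<kappa> i = b \<and> i \<in> S'}"
      by (auto simp: \<kappa>1_def) presburger+
    ultimately show ?thesis using S'(3)[of b] that by simp
  qed
  obtain T' where T': "T' \<subseteq> V"
      "\<bar>\<Sum>j\<in>T. \<Sum>i\<in>S'. w i * w j * (\<beta> i j - av \<kappa> i j)\<bar> \<le>
        6 * \<bar>\<Sum>j\<in>T'. \<Sum>i\<in>S'. w i * w j * (\<beta> i j - av \<kappa> i j)\<bar>"
      "\<And>a. a < 2 * m \<Longrightarrow> \<eta> / 4 / 4 \<le> (\<Sum>i\<in>{i \<in> V. \<kappa>1 i = a \<and> i \<in> T'}. w i)"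
      "\<And>a. a < 2 * m \<Longrightarrow> \<eta> / 4 / 4 \<le> (\<Sum>i\<in>{i \<in> V. \<kappa>1 i = a \<and> i \<notin> T'}. w i)"
    using balanced_subset[where w = w, OF finite_V small'(2), where \<kappa> = \<kappa>1 and m = "2 * m" and S = T
       and c = "\<lambda>j. \<Sum>i\<in>S'. w i * w j * (\<beta> i j - av \<kappa> i j)"] \<eta> cl1 ST(2) by auto
  define \<kappa>2 where "\<kappa>2 i = 2 * \<kappa>1 i + (if i \<in> T' then 1 else 0)" for i
  have cl2: "\<eta> / 16 \<le> sum w (block \<kappa>2 a)" if "a < 4 * m" for a
  proof (cases "even a")
    case True
    then obtain b where "a = 2 * b" by blast
    moreover have "block \<kappa>2 (2 * b) = {i \<in> V. \<kappa>1 i = b \<and> i \<notin> T'}"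
      by (auto simp: \<kappa>2_def block_def) presburger+
    ultimately show ?thesis using T'(4)[of b] that by simp
  next
    case False
    then obtain b where "a = 2 * b + 1" by (meson oddE)
    moreover have "block \<kappa>2 (2 * b + 1) = {i \<in> V. \<kappa>1 i = b \<and> i \<in> T'}"
      by (auto simp: \<kappa>2_def block_def) presburger+
    ultimately show ?thesis using T'(3)[of b] that by simp
  qed
  have \<kappa>: "\<kappa>2 i div 4 = \<kappa> i" for i
    by (simp add: \<kappa>2_def \<kappa>1_def; presburger)
  have inS: "i \<in> S' \<longleftrightarrow> odd (\<kappa>2 i div 2)" and inT: "i \<in> T' \<longleftrightarrow> odd (\<kappa>2 i)" for i
    by (auto simp: \<kappa>2_def \<kappa>1_def)
  \<comment> \<open>The indicator of \<open>S' \<times> T'\<close> as a function of the new labels.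
    Tested against it, \<open>\<beta>\<close> may be replaced by its finer average, so the
    discrepancy becomes a difference of two averages.\<close>
  define H where "H a b = (if odd (a div 2) \<and> odd b then 1 else 0 :: real)" for a b :: nat
  have "g S' T' = (\<Sum>i\<in>V. \<Sum>j\<in>V. if i \<in> S' then if j \<in> T' then w i * w j * (\<beta> i j - av \<kappa> i j) else 0 else 0)"
  proof -
    have "V \<inter> S' = S'" "V \<inter> T' = T'" using S'(1) T'(1) by auto
    then have a: "(\<Sum>j\<in>V. if j \<in> T' then f j else 0) = sum f T'"
      and b: "(\<Sum>j\<in>V. if j \<in> S' then f j else 0) = sum f S'" for f :: "'v \<Rightarrow> real"
      using sum.inter_restrict[OF finite_V, of f T'] sum.inter_restrict[OF finite_V, of f S'] by auto
    have c: "(\<Sum>j\<in>V. if P then f j else 0) = (if P then sum f V else 0)" for P and f :: "'v \<Rightarrow> real"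
      by auto
    show ?thesis unfolding c a b g_def ..
  qed
  also have "\<dots> = mean (\<lambda>i j. H (\<kappa>2 i) (\<kappa>2 j) * (\<beta> i j - av \<kappa> i j))"
    unfolding mean_def by (intro sum.cong refl) (simp add: H_def inS inT)
  also have "\<dots> = mean (\<lambda>i j. H (\<kappa>2 i) (\<kappa>2 j) * (av \<kappa>2 i j - av \<kappa> i j))"
    unfolding right_diff_distrib mean_diff mean_avg[of H \<kappa>2] ..
  also have "\<bar>\<dots>\<bar> \<le> mean (\<lambda>i j. \<bar>av \<kappa>2 i j - av \<kappa> i j\<bar>)"
    unfolding mean_def
  proof (intro order_trans[OF sum_abs] sum_mono)
    fix i j assume "i \<in> V" "j \<in> V"
    then show "\<bar>w i * w j * (H (\<kappa>2 i) (\<kappa>2 j) * (av \<kappa>2 i j - av \<kappa> i j))\<bar>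
        \<le> w i * w j * \<bar>av \<kappa>2 i j - av \<kappa> i j\<bar>"
      using w_pos[of i] w_pos[of j] by (simp add: abs_mult H_def)
  qed
  finally have 1: "\<bar>g S' T'\<bar> \<le> mean (\<lambda>i j. \<bar>av \<kappa>2 i j - av \<kappa> i j\<bar>)" .
  have "\<bar>g S T\<bar> \<le> 6 * \<bar>g S' T\<bar>" using S'(2) by (simp add: g_def)
  moreover have "\<bar>g S' T\<bar> \<le> 6 * \<bar>g S' T'\<bar>"
    using T'(2) unfolding sum.swap[of _ S'] by (simp add: g_def)
  ultimately have "\<bar>g S T\<bar> \<le> 36 * mean (\<lambda>i j. \<bar>av \<kappa>2 i j - av \<kappa> i j\<bar>)"
    using 1 by linarith
  then have "\<bar>g S0 T0\<bar> \<le> 36 * mean (\<lambda>i j. \<bar>av \<kappa>2 i j - av \<kappa> i j\<bar>)"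
    if "S0 \<subseteq> V" "T0 \<subseteq> V" for S0 T0
    using max[OF that] by linarith
  then show ?thesis using \<kappa> cl2 unfolding g_def by blast
qed


text \<open>The depth \<open>K\<close> is fixed in advance by how small the vertex weights are. The
  discrepancy at level \<open>k\<close> is measured by the move to level \<open>Suc k\<close>, so
  the last level has no such bound.\<close>

lemma refinement_chain:
  assumes small: "\<And>i. i \<in> V \<Longrightarrow> w i \<le> 1 / 16 ^ K / 32"
  shows "\<exists>\<kappa>. (\<forall>k<K. \<forall>i\<in>V. \<kappa> (Suc k) i div 4 = \<kappa> k i) \<and>
    (\<forall>k\<le>K. (\<forall>i\<in>V. \<kappa> k i < 4 ^ k) \<and> (\<forall>a<4 ^ k. 1 / 16 ^ k \<le> sum w (block (\<kappa> k) a))) \<and>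
    (\<forall>k<K. \<forall>S\<subseteq>V. \<forall>T\<subseteq>V. \<bar>\<Sum>i\<in>S. \<Sum>j\<in>T. w i * w j * (\<beta> i j - av (\<kappa> k) i j)\<bar>
       \<le> 36 * mean (\<lambda>i j. \<bar>av (\<kappa> (Suc k)) i j - av (\<kappa> k) i j\<bar>))"
  using assms
proof (induction K)
  case 0
  show ?case
    by (rule exI[of _ "\<lambda>k i. 0"]) (auto simp: block_def sum_w)
next
  case (Suc K)
  have "(1::real) / 16 ^ Suc K / 32 \<le> 1 / 16 ^ K / 32" by (simp add: field_simps)
  then have small: "\<And>i. i \<in> V \<Longrightarrow> w i \<le> 1 / 16 ^ K / 32"
    using Suc.prems by (meson order_trans)
  obtain \<kappa> where *: "(\<forall>k<K. \<forall>i\<in>V. \<kappa> (Suc k) i div 4 = \<kappa> k i) \<and>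
    (\<forall>k\<le>K. (\<forall>i\<in>V. \<kappa> k i < 4 ^ k) \<and> (\<forall>a<4 ^ k. 1 / 16 ^ k \<le> sum w (block (\<kappa> k) a))) \<and>
    (\<forall>k<K. \<forall>S\<subseteq>V. \<forall>T\<subseteq>V. \<bar>\<Sum>i\<in>S. \<Sum>j\<in>T. w i * w j * (\<beta> i j - av (\<kappa> k) i j)\<bar>
       \<le> 36 * mean (\<lambda>i j. \<bar>av (\<kappa> (Suc k)) i j - av (\<kappa> k) i j\<bar>))"
    using Suc.IH[OF small] by (rule exE)
  have \<kappa>:
    "\<And>k i. k < K \<Longrightarrow> i \<in> V \<Longrightarrow> \<kappa> (Suc k) i div 4 = \<kappa> k i"
    "\<And>k i. k \<le> K \<Longrightarrow> i \<in> V \<Longrightarrow> \<kappa> k i < 4 ^ k"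
    "\<And>k a. k \<le> K \<Longrightarrow> a < 4 ^ k \<Longrightarrow> 1 / 16 ^ k \<le> sum w (block (\<kappa> k) a)"
    "\<And>k S T. k < K \<Longrightarrow> S \<subseteq> V \<Longrightarrow> T \<subseteq> V \<Longrightarrow>
       \<bar>\<Sum>i\<in>S. \<Sum>j\<in>T. w i * w j * (\<beta> i j - av (\<kappa> k) i j)\<bar>
       \<le> 36 * mean (\<lambda>i j. \<bar>av (\<kappa> (Suc k)) i j - av (\<kappa> k) i j\<bar>)"
    using * by blast+
  obtain \<kappa>' where \<kappa>': "\<forall>i\<in>V. \<kappa>' i div 4 = \<kappa> K i"
    "\<forall>a<4 * 4 ^ K. 1 / 16 ^ K / 16 \<le> sum w (block \<kappa>' a)"
    "\<forall>S\<subseteq>V. \<forall>T\<subseteq>V. \<bar>\<Sum>i\<in>S. \<Sum>j\<in>T. w i * w j * (\<beta> i j - av (\<kappa> K) i j)\<bar>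
       \<le> 36 * mean (\<lambda>i j. \<bar>av \<kappa>' i j - av (\<kappa> K) i j\<bar>)"
    using refine_once[of "\<kappa> K" "4 ^ K" "1 / 16 ^ K"] \<kappa>(2)[of K] \<kappa>(3)[of K] small by auto
  have lt: "\<kappa>' i < 4 ^ Suc K" if "i \<in> V" for i
  proof -
    have "\<kappa>' i div 4 < 4 ^ K" using \<kappa>' \<kappa>(2)[of K i] that by simp
    then show ?thesis by (simp add: div_less_iff_less_mult mult.commute)
  qed
  have big: "1 / 16 ^ Suc K \<le> sum w (block \<kappa>' a)" if "a < 4 ^ Suc K" for a
    using \<kappa>'(2) that by (simp add: mult.commute)
  show ?case
  proof (rule exI[of _ "\<kappa>(Suc K := \<kappa>')"], intro conjI allI impI ballI)
    fix k i assume "k < Suc K" "i \<in> V"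
    then show "(\<kappa>(Suc K := \<kappa>')) (Suc k) i div 4 = (\<kappa>(Suc K := \<kappa>')) k i"
      using \<kappa>(1) \<kappa>'(1) by (cases "k = K") auto
  next
    fix k i assume "k \<le> Suc K" "i \<in> V"
    then show "(\<kappa>(Suc K := \<kappa>')) k i < 4 ^ k"
      using \<kappa>(2) lt by (cases "k = Suc K") auto
  next
    fix k and a :: nat assume "k \<le> Suc K" "a < 4 ^ k"
    then show "1 / 16 ^ k \<le> sum w (block ((\<kappa>(Suc K := \<kappa>')) k) a)"
      using \<kappa>(3) big by (cases "k = Suc K") auto
  next
    fix k S T assume "k < Suc K" "S \<subseteq> V" "T \<subseteq> V"
    then show "\<bar>\<Sum>i\<in>S. \<Sum>j\<in>T. w i * w j * (\<beta> i j - av ((\<kappa>(Suc K := \<kappa>')) k) i j)\<bar>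
       \<le> 36 * mean (\<lambda>i j. \<bar>av ((\<kappa>(Suc K := \<kappa>')) (Suc k)) i j - av ((\<kappa>(Suc K := \<kappa>')) k) i j\<bar>)"
      using \<kappa>(4) \<kappa>'(3) by (cases "k = K") auto
  qed
qed

end

section \<open>Energy increments\<close>

text \<open>
  The right-hand side is the Bregman divergence of \<open>\<lambda>x. sqrt (1 + x\<^sup>2)\<close>, a strictly convex function of
  linear growth, so that its mean is bounded using the \<open>L\<^sup>1\<close> normalisation only.
\<close>

lemma bregman_sqrt:
  fixes x y :: real
  shows "(y - x)\<^sup>2 / (2 * (1 + x\<^sup>2) * sqrt (1 + y\<^sup>2))
    \<le> sqrt (1 + y\<^sup>2) - sqrt (1 + x\<^sup>2) - x / sqrt (1 + x\<^sup>2) * (y - x)"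
proof -
  define a b where "a = sqrt (1 + x\<^sup>2)" and "b = sqrt (1 + y\<^sup>2)"
  have ab: "a > 0" "b > 0" "a\<^sup>2 = 1 + x\<^sup>2" "b\<^sup>2 = 1 + y\<^sup>2"
    unfolding a_def b_def by (auto simp: add_pos_nonneg)
  \<comment> \<open>Lagrange's identity for the vectors \<open>(1, x)\<close> and
    \<open>(1, y)\<close>. The divergence equals \<open>(a * b - (1 + x * y)) / a\<close>, so the
    exact defect in Cauchy-Schwarz is what is wanted.\<close>
  have sq: "(a * b)\<^sup>2 - (1 + x * y)\<^sup>2 = (y - x)\<^sup>2"
    unfolding power_mult_distrib ab by (simp add: power2_eq_square algebra_simps)
  have "\<bar>1 + x * y\<bar> \<le> a * b"
  proof -
    have "(1 + x * y)\<^sup>2 \<le> (a * b)\<^sup>2" using sq zero_le_power2[of "y - x"] by linarith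
    then have "\<bar>1 + x * y\<bar> \<le> \<bar>a * b\<bar>" by (simp only: abs_le_square_iff)
    then show ?thesis using ab by (simp add: abs_mult)
  qed
  then have le: "1 + x * y \<le> a * b" "- (a * b) \<le> 1 + x * y" by auto
  have "b - a - x / a * (y - x) = (a * b - (1 + x * y)) / a"
  proof -
    have "a * (b - a - x / a * (y - x)) = a * b - a\<^sup>2 - x * (y - x)"
      using ab(1) by (simp add: field_simps power2_eq_square)
    also have "\<dots> = a * b - (1 + x * y)" unfolding ab by (simp add: power2_eq_square algebra_simps)
    finally show ?thesis using ab(1) by (simp add: eq_divide_eq mult.commute)
  qed
  moreover have "(y - x)\<^sup>2 / (2 * a\<^sup>2 * b) \<le> (a * b - (1 + x * y)) / a"
  proof -
    have "(y - x)\<^sup>2 = (a * b - (1 + x * y)) * (a * b + (1 + x * y))"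
      using sq by (simp add: power2_eq_square algebra_simps)
    also have "\<dots> \<le> (a * b - (1 + x * y)) * (2 * (a * b))"
      using le by (intro mult_left_mono) auto
    finally have "(y - x)\<^sup>2 / (2 * a\<^sup>2 * b) \<le> (a * b - (1 + x * y)) * (2 * (a * b)) / (2 * a\<^sup>2 * b)"
      using ab by (intro divide_right_mono) auto
    also have "\<dots> = (a * b - (1 + x * y)) / a"
      using ab(1,2) by (simp add: power2_eq_square field_simps)
    finally show ?thesis .
  qed
  ultimately show ?thesis unfolding a_def[symmetric] b_def[symmetric] unfolding ab(3)[symmetric] by simp
qed

text \<open>Where both square roots are at most \<open>M\<close>, the divergence is at least
  \<open>(y - x)\<^sup>2 / (2 * M ^ 3)\<close>, and the square is made linear at the price of
  \<open>\<epsilon>\<close>. Elsewhere the larger of them exceeds \<open>M\<close>, and its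
  \<open>q\<close>-th power times \<open>M powr (1 - q)\<close> controls the difference.\<close>

lemma abs_diff_le_bregman:
  fixes x y :: real
  assumes \<epsilon>: "0 < \<epsilon>" and M: "1 \<le> M" and q: "1 < q"
  shows "\<bar>y - x\<bar> \<le> \<epsilon> + M ^ 3 / (2 * \<epsilon>) *
      (sqrt (1 + y\<^sup>2) - sqrt (1 + x\<^sup>2) - x / sqrt (1 + x\<^sup>2) * (y - x)) +
      2 * 2 powr q * M powr (1 - q) * (2 + \<bar>x\<bar> powr q + \<bar>y\<bar> powr q)"
proof -
  define a b where "a = sqrt (1 + x\<^sup>2)" and "b = sqrt (1 + y\<^sup>2)"
  define B where "B = b - a - x / a * (y - x)"
  have ab: "a \<ge> 1" "b \<ge> 1" "a\<^sup>2 = 1 + x\<^sup>2"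
    unfolding a_def b_def by auto
  have B: "(y - x)\<^sup>2 / (2 * a\<^sup>2 * b) \<le> B"
    unfolding ab(3) using bregman_sqrt[of y x] by (simp add: a_def b_def B_def)
  have "0 \<le> (y - x)\<^sup>2 / (2 * a\<^sup>2 * b)" using ab by simp
  with B have B0: "0 \<le> B" by linarith
  have tail0: "0 \<le> 2 * 2 powr q * M powr (1 - q) * (2 + \<bar>x\<bar> powr q + \<bar>y\<bar> powr q)"
    by (intro mult_nonneg_nonneg add_nonneg_nonneg) auto
  have "\<bar>y - x\<bar> \<le> \<epsilon> + M ^ 3 / (2 * \<epsilon>) * B + 2 * 2 powr q * M powr (1 - q) * (2 + \<bar>x\<bar> powr q + \<bar>y\<bar> powr q)"
  proof (cases "a \<le> M \<and> b \<le> M")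
    case True
    have "2 * a\<^sup>2 * b \<le> 2 * M\<^sup>2 * M"
      using True ab by (intro mult_mono power_mono) auto
    then have "(y - x)\<^sup>2 / (2 * M ^ 3) \<le> (y - x)\<^sup>2 / (2 * a\<^sup>2 * b)"
    proof (intro divide_left_mono)
      show "2 * a\<^sup>2 * b \<le> 2 * M ^ 3"
        using \<open>2 * a\<^sup>2 * b \<le> 2 * M\<^sup>2 * M\<close> by (simp add: power2_eq_square power3_eq_cube)
      have "0 < a" "0 < b" "0 < M" using ab M by linarith+
      then show "0 < 2 * M ^ 3 * (2 * a\<^sup>2 * b)" by simp
    qed simp
    then have "(y - x)\<^sup>2 / (2 * M ^ 3) \<le> B" using B by linarith
    then have t2: "(y - x)\<^sup>2 \<le> 2 * M ^ 3 * B" using M by (simp add: field_simps)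
    \<comment> \<open>The inequality of arithmetic and geometric means, weighted so that the
      constant term comes out as \<open>\<epsilon>\<close>.\<close>
    have "0 \<le> (\<bar>y - x\<bar> - 2 * \<epsilon>)\<^sup>2" by simp
    then have "4 * \<epsilon> * \<bar>y - x\<bar> \<le> 4 * \<epsilon>\<^sup>2 + (y - x)\<^sup>2"
      by (simp add: power2_diff power_mult_distrib mult_ac)
    also have "\<dots> \<le> 4 * \<epsilon>\<^sup>2 + 2 * M ^ 3 * B" using t2 by simp
    also have "\<dots> = 4 * \<epsilon> * (\<epsilon> + M ^ 3 / (2 * \<epsilon>) * B)"
      using \<epsilon> by (simp add: distrib_left power2_eq_square)
    finally have "\<bar>y - x\<bar> \<le> \<epsilon> + M ^ 3 / (2 * \<epsilon>) * B" using \<epsilon> by simp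
    then show ?thesis using tail0 by linarith
  next
    case False
    define m where "m = max a b"
    have m: "M < m" "1 \<le> m" using False ab by (auto simp: m_def)
    have xa: "\<bar>x\<bar> \<le> a" "\<bar>y\<bar> \<le> b" unfolding a_def b_def
      by (auto intro!: real_le_rsqrt)
    have *: "sqrt (1 + z\<^sup>2) powr q \<le> 2 powr q * (1 + \<bar>z\<bar> powr q)" for z :: real
    proof -
      have "sqrt (1 + z\<^sup>2) \<le> 1 + \<bar>z\<bar>"
        by (rule real_le_lsqrt) (auto simp: power2_sum)
      also have "\<dots> \<le> 2 * max 1 \<bar>z\<bar>" by auto
      finally have "sqrt (1 + z\<^sup>2) powr q \<le> (2 * max 1 \<bar>z\<bar>) powr q"
        using q by (intro powr_mono2) auto
      also have "\<dots> = 2 powr q * max 1 \<bar>z\<bar> powr q" by (simp add: powr_mult)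
      also have "\<dots> \<le> 2 powr q * (1 + \<bar>z\<bar> powr q)"
        by (intro mult_left_mono) (auto simp: max_def)
      finally show ?thesis .
    qed
    have "m powr q \<le> a powr q + b powr q"
      by (auto simp: m_def max_def)
    also have "\<dots> \<le> 2 powr q * (2 + \<bar>x\<bar> powr q + \<bar>y\<bar> powr q)"
      using *[of x] *[of y] by (simp add: a_def b_def distrib_left)
    finally have mq: "m powr q \<le> 2 powr q * (2 + \<bar>x\<bar> powr q + \<bar>y\<bar> powr q)" .
    \<comment> \<open>The exponent \<open>1 - q\<close> is negative, so replacing \<open>m\<close>
      by the smaller \<open>M\<close> in the second factor increases it.\<close>
    have "m = m powr q * m powr (1 - q)"
      using m by (simp add: powr_add[symmetric])
    also have "\<dots> \<le> m powr q * M powr (1 - q)"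
      using m M q by (intro mult_left_mono powr_mono2') auto
    also have "\<dots> \<le> 2 powr q * (2 + \<bar>x\<bar> powr q + \<bar>y\<bar> powr q) * M powr (1 - q)"
      by (rule mult_right_mono[OF mq]) simp
    finally have "m \<le> 2 powr q * (2 + \<bar>x\<bar> powr q + \<bar>y\<bar> powr q) * M powr (1 - q)" .
    moreover have "\<bar>y - x\<bar> \<le> 2 * m" using xa by (auto simp: m_def)
    ultimately have "\<bar>y - x\<bar> \<le> 2 * (2 powr q * (2 + \<bar>x\<bar> powr q + \<bar>y\<bar> powr q) * M powr (1 - q))"
      by linarith
    moreover have "0 \<le> \<epsilon> + M ^ 3 / (2 * \<epsilon>) * B"
      using \<epsilon> M B0 by simp
    ultimately show ?thesis by (simp add: mult_ac)
  qed
  then show ?thesis by (simp add: B_def a_def b_def)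
qed

context kernel
begin

definition energy :: "('v \<Rightarrow> nat) \<Rightarrow> real" where
  "energy \<kappa> = mean (\<lambda>i j. sqrt (1 + (av \<kappa> i j)\<^sup>2))"

lemma energy_bounds: "0 \<le> energy \<kappa>" "energy \<kappa> \<le> 2"
proof -
  have "mean (\<lambda>i j. 0) \<le> energy \<kappa>"
    unfolding energy_def by (intro mean_mono) auto
  then show "0 \<le> energy \<kappa>" by (simp add: mean_const)
  have "energy \<kappa> \<le> mean (\<lambda>i j. 1 + \<bar>av \<kappa> i j\<bar>)"
    unfolding energy_def by (intro mean_mono real_le_lsqrt) (auto simp: power2_sum)
  then show "energy \<kappa> \<le> 2"
    using mean_abs_avg[of \<kappa>] by (simp add: mean_add mean_const)
qed

text \<open>The martingale property: a function of the coarse labels is also one of the fine labels,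
  and against it both averages have the same mean as \<open>\<beta>\<close>.\<close>

lemma mean_avg_diff:
  assumes "\<And>i. i \<in> V \<Longrightarrow> \<kappa> i = f (\<kappa>' i)"
  shows "mean (\<lambda>i j. H (\<kappa> i) (\<kappa> j) * (av \<kappa>' i j - av \<kappa> i j)) = 0"
proof -
  have "mean (\<lambda>i j. H (\<kappa> i) (\<kappa> j) * av \<kappa>' i j) = mean (\<lambda>i j. H (f (\<kappa>' i)) (f (\<kappa>' j)) * av \<kappa>' i j)"
    by (intro mean_cong) (simp add: assms)
  also have "\<dots> = mean (\<lambda>i j. H (f (\<kappa>' i)) (f (\<kappa>' j)) * \<beta> i j)"
    by (rule mean_avg[where H = "\<lambda>a b. H (f a) (f b)"])
  also have "\<dots> = mean (\<lambda>i j. H (\<kappa> i) (\<kappa> j) * \<beta> i j)"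
    by (intro mean_cong) (simp add: assms)
  also have "\<dots> = mean (\<lambda>i j. H (\<kappa> i) (\<kappa> j) * av \<kappa> i j)"
    by (rule mean_avg[symmetric])
  finally show ?thesis by (simp add: right_diff_distrib mean_diff)
qed

text \<open>The first-order term of the divergence is a coarse function times a martingale increment
  and has mean zero. The energy gap is therefore the mean of a nonnegative divergence.\<close>

lemma energy_diff:
  assumes "\<And>i. i \<in> V \<Longrightarrow> \<kappa> i = f (\<kappa>' i)"
  shows "energy \<kappa>' - energy \<kappa> = mean (\<lambda>i j. sqrt (1 + (av \<kappa>' i j)\<^sup>2) - sqrt (1 + (av \<kappa> i j)\<^sup>2)
    - av \<kappa> i j / sqrt (1 + (av \<kappa> i j)\<^sup>2) * (av \<kappa>' i j - av \<kappa> i j))"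
proof -
  have "mean (\<lambda>i j. av \<kappa> i j / sqrt (1 + (av \<kappa> i j)\<^sup>2) * (av \<kappa>' i j - av \<kappa> i j)) = 0"
    by (rule mean_avg_diff[where f = f and H = "\<lambda>a b. avg \<kappa> a b / sqrt (1 + (avg \<kappa> a b)\<^sup>2)"])
      (rule assms)
  then show ?thesis unfolding energy_def mean_diff by simp
qed

lemma energy_mono:
  assumes "\<And>i. i \<in> V \<Longrightarrow> \<kappa> i = f (\<kappa>' i)"
  shows "energy \<kappa> \<le> energy \<kappa>'"
proof -
  have eq: "energy \<kappa>' - energy \<kappa> = mean (\<lambda>i j. sqrt (1 + (av \<kappa>' i j)\<^sup>2) - sqrt (1 + (av \<kappa> i j)\<^sup>2)
    - av \<kappa> i j / sqrt (1 + (av \<kappa> i j)\<^sup>2) * (av \<kappa>' i j - av \<kappa> i j))"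
    by (rule energy_diff) (rule assms)
  have "mean (\<lambda>i j. 0) \<le> energy \<kappa>' - energy \<kappa>"
    unfolding eq
    by (intro mean_mono order_trans[OF _ bregman_sqrt]) (simp add: add_nonneg_nonneg)
  then show ?thesis by (simp add: mean_const)
qed

text \<open>To be used with \<open>\<epsilon>\<close> small and \<open>M\<close> large enough for
  the last term, and only then an energy gap small compared with \<open>\<epsilon> / M ^ 3\<close>.
  The moment bound \<open>K\<close> plays the part of uniform integrability.\<close>

lemma mean_diff_le_energy_diff:
  assumes coarser: "\<And>i. i \<in> V \<Longrightarrow> \<kappa> i = f (\<kappa>' i)" and "0 < \<epsilon>" "1 \<le> M" "1 < q"
    and K: "mean (\<lambda>i j. \<bar>av \<kappa> i j\<bar> powr q) \<le> K" "mean (\<lambda>i j. \<bar>av \<kappa>' i j\<bar> powr q) \<le> K"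
  shows "mean (\<lambda>i j. \<bar>av \<kappa>' i j - av \<kappa> i j\<bar>) \<le> \<epsilon> + M ^ 3 / (2 * \<epsilon>) * (energy \<kappa>' - energy \<kappa>)
    + 2 * 2 powr q * M powr (1 - q) * (2 + K + K)"
proof -
  define c where "c = 2 * 2 powr q * M powr (1 - q)"
  have eq: "energy \<kappa>' - energy \<kappa> = mean (\<lambda>i j. sqrt (1 + (av \<kappa>' i j)\<^sup>2) - sqrt (1 + (av \<kappa> i j)\<^sup>2)
    - av \<kappa> i j / sqrt (1 + (av \<kappa> i j)\<^sup>2) * (av \<kappa>' i j - av \<kappa> i j))"
    by (rule energy_diff) (rule coarser)
  have "mean (\<lambda>i j. \<bar>av \<kappa>' i j - av \<kappa> i j\<bar>) \<le> mean (\<lambda>i j. \<epsilon> + M ^ 3 / (2 * \<epsilon>) *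
      (sqrt (1 + (av \<kappa>' i j)\<^sup>2) - sqrt (1 + (av \<kappa> i j)\<^sup>2)
        - av \<kappa> i j / sqrt (1 + (av \<kappa> i j)\<^sup>2) * (av \<kappa>' i j - av \<kappa> i j)) +
      c * (2 + \<bar>av \<kappa> i j\<bar> powr q + \<bar>av \<kappa>' i j\<bar> powr q))"
    unfolding c_def by (intro mean_mono abs_diff_le_bregman assms)
  also have "\<dots> = \<epsilon> + M ^ 3 / (2 * \<epsilon>) * (energy \<kappa>' - energy \<kappa>)
     + c * (2 + mean (\<lambda>i j. \<bar>av \<kappa> i j\<bar> powr q) + mean (\<lambda>i j. \<bar>av \<kappa>' i j\<bar> powr q))"
    unfolding eq by (simp only: mean_add mean_const mean_cmult)
  also have "\<dots> \<le> \<epsilon> + M ^ 3 / (2 * \<epsilon>) * (energy \<kappa>' - energy \<kappa>) + c * (2 + K + K)"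
    using K by (intro add_left_mono mult_left_mono) (auto simp: c_def)
  finally show ?thesis by (simp add: c_def)
qed

end

section \<open>From vertex sets to fractional vertex sets\<close>

lemma fractional_sum_le:
  fixes f c :: "'v \<Rightarrow> real"
  assumes "finite V" "\<And>i. i \<in> V \<Longrightarrow> 0 \<le> f i \<and> f i \<le> 1"
  shows "\<exists>S\<subseteq>V. \<bar>\<Sum>i\<in>V. f i * c i\<bar> \<le> \<bar>sum c S\<bar>"
proof -
  \<comment> \<open>A linear function on a cube takes its extreme values at vertices, here the
    positive and the negative coefficients.\<close>
  define P N where "P = {i \<in> V. 0 \<le> c i}" and "N = {i \<in> V. c i < 0}"
  have "f i * c i \<le> (if 0 \<le> c i then c i else 0)" if "i \<in> V" for i
    using assms(2)[OF that] by (auto simp: mult_le_cancel_right2 mult_le_0_iff)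
  then have "(\<Sum>i\<in>V. f i * c i) \<le> (\<Sum>i\<in>V. if 0 \<le> c i then c i else 0)"
    by (intro sum_mono)
  also have "\<dots> = sum c P"
    unfolding P_def using assms(1) by (simp add: sum.inter_filter)
  finally have 1: "(\<Sum>i\<in>V. f i * c i) \<le> sum c P" .
  have "(if c i < 0 then c i else 0) \<le> f i * c i" if "i \<in> V" for i
    using assms(2)[OF that] by (auto simp: mult_le_cancel_right1)
  then have "(\<Sum>i\<in>V. if c i < 0 then c i else 0) \<le> (\<Sum>i\<in>V. f i * c i)"
    by (intro sum_mono)
  moreover have "(\<Sum>i\<in>V. if c i < 0 then c i else 0) = sum c N"
    unfolding N_def using assms(1) by (simp add: sum.inter_filter)
  ultimately have 2: "sum c N \<le> (\<Sum>i\<in>V. f i * c i)" by simp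
  show ?thesis
  proof (cases "0 \<le> (\<Sum>i\<in>V. f i * c i)")
    case True
    then show ?thesis using 1 by (intro exI[of _ P]) (auto simp: P_def)
  next
    case False
    then show ?thesis using 2 by (intro exI[of _ N]) (auto simp: N_def)
  qed
qed

text \<open>Bilinearity allows rounding one variable at a time. This handles measurable sets that
  cover cells only in part.\<close>

lemma fractional_double_sum_le:
  fixes c :: "'v \<Rightarrow> 'v \<Rightarrow> real"
  assumes fin: "finite V" and f: "\<And>i. i \<in> V \<Longrightarrow> 0 \<le> f i \<and> f i \<le> 1"
    and g: "\<And>i. i \<in> V \<Longrightarrow> 0 \<le> g i \<and> g i \<le> 1"
    and D: "\<And>S T. S \<subseteq> V \<Longrightarrow> T \<subseteq> V \<Longrightarrow> \<bar>\<Sum>i\<in>S. \<Sum>j\<in>T. c i j\<bar> \<le> D"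
  shows "\<bar>\<Sum>i\<in>V. \<Sum>j\<in>V. f i * g j * c i j\<bar> \<le> D"
proof -
  obtain S where S: "S \<subseteq> V"
    "\<bar>\<Sum>i\<in>V. f i * (\<Sum>j\<in>V. g j * c i j)\<bar> \<le> \<bar>\<Sum>i\<in>S. \<Sum>j\<in>V. g j * c i j\<bar>"
    using fractional_sum_le[where V = V and f = f, OF fin f, of "\<lambda>i. \<Sum>j\<in>V. g j * c i j"] by auto
  obtain T where T: "T \<subseteq> V"
    "\<bar>\<Sum>j\<in>V. g j * (\<Sum>i\<in>S. c i j)\<bar> \<le> \<bar>\<Sum>j\<in>T. \<Sum>i\<in>S. c i j\<bar>"
    using fractional_sum_le[where V = V and f = g, OF fin g, of "\<lambda>j. \<Sum>i\<in>S. c i j"] by auto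
  have "\<bar>\<Sum>i\<in>V. \<Sum>j\<in>V. f i * g j * c i j\<bar> \<le> \<bar>\<Sum>i\<in>S. \<Sum>j\<in>V. g j * c i j\<bar>"
    using S(2) by (simp add: sum_distrib_left mult_ac)
  also have "(\<Sum>i\<in>S. \<Sum>j\<in>V. g j * c i j) = (\<Sum>j\<in>V. g j * (\<Sum>i\<in>S. c i j))"
    by (subst sum.swap) (simp add: sum_distrib_left)
  also have "\<bar>\<dots>\<bar> \<le> \<bar>\<Sum>j\<in>T. \<Sum>i\<in>S. c i j\<bar>" by (rule T)
  also have "(\<Sum>j\<in>T. \<Sum>i\<in>S. c i j) = (\<Sum>i\<in>S. \<Sum>j\<in>T. c i j)" by (rule sum.swap)
  also have "\<bar>\<dots>\<bar> \<le> D" by (rule D) fact+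
  finally show ?thesis .
qed

section \<open>Step functions on the unit square\<close>

text \<open>The left ends are kept apart from the lengths, so that the same vertices can be laid out
  in several orders.\<close>

definition cell :: "('v \<Rightarrow> real) \<Rightarrow> ('v \<Rightarrow> real) \<Rightarrow> 'v \<Rightarrow> real set" where
  "cell w l i = {l i ..< l i + w i}"

definition tiling :: "'v set \<Rightarrow> ('v \<Rightarrow> real) \<Rightarrow> ('v \<Rightarrow> real) \<Rightarrow> bool" where
  "tiling V w l \<longleftrightarrow> finite V \<and> (\<forall>i\<in>V. 0 < w i) \<and> disjoint_family_on (cell w l) V \<and>
     (\<Union>i\<in>V. cell w l i) = {0..<1}"

lemma cell_borel [measurable]: "cell w l i \<in> sets borel"
  by (simp add: cell_def)

lemma tilingD:
  assumes "tiling V w l"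
  shows "finite V" "\<And>i. i \<in> V \<Longrightarrow> 0 < w i" "disjoint_family_on (cell w l) V"
    "(\<Union>i\<in>V. cell w l i) = {0..<1}"
    "\<And>i x. i \<in> V \<Longrightarrow> x \<in> cell w l i \<Longrightarrow> 0 \<le> x \<and> x < 1"
    "\<And>i j x. i \<in> V \<Longrightarrow> j \<in> V \<Longrightarrow> x \<in> cell w l i \<Longrightarrow> x \<in> cell w l j \<Longrightarrow> i = j"
proof -
  show "finite V" "\<And>i. i \<in> V \<Longrightarrow> 0 < w i" "disjoint_family_on (cell w l) V"
    "(\<Union>i\<in>V. cell w l i) = {0..<1}" using assms by (auto simp: tiling_def)
  then show "\<And>i x. i \<in> V \<Longrightarrow> x \<in> cell w l i \<Longrightarrow> 0 \<le> x \<and> x < 1"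
    by (metis UN_I atLeastLessThan_iff)
  show "\<And>i j x. i \<in> V \<Longrightarrow> j \<in> V \<Longrightarrow> x \<in> cell w l i \<Longrightarrow> x \<in> cell w l j \<Longrightarrow> i = j"
    using assms by (auto simp: tiling_def disjoint_family_on_def)
qed

lemma tiling_cell:
  assumes "tiling V w l" "0 \<le> x" "x < 1"
  obtains i where "i \<in> V" "x \<in> cell w l i"
proof -
  have "x \<in> (\<Union>i\<in>V. cell w l i)" using assms tilingD(4)[OF assms(1)] by auto
  then show ?thesis using that by auto
qed

text \<open>Needed for two orders of the same vertices: the vertex order that defines the graphon of
  a graph, and the order that makes blocks contiguous.\<close>

lemma tiling_of_key:
  fixes g :: "'v \<Rightarrow> 'o::linorder"
  assumes fin: "finite V" and w: "\<And>i. i \<in> V \<Longrightarrow> 0 < w i" and sum: "sum w V = 1" and inj: "inj_on g V"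
  shows "tiling V w (\<lambda>i. \<Sum>j\<in>{j \<in> V. g j < g i}. w j)"
proof -
  define l where "l i = (\<Sum>j\<in>{j \<in> V. g j < g i}. w j)" for i
  have mono: "sum w A \<le> sum w B" if "A \<subseteq> B" "B \<subseteq> V" for A B
    using that fin w by (intro sum_mono2) (auto intro: finite_subset less_imp_le)
  have r: "l i + w i = (\<Sum>j\<in>{j \<in> V. g j \<le> g i}. w j)" if "i \<in> V" for i
  proof -
    have "{j \<in> V. g j \<le> g i} = insert i {j \<in> V. g j < g i}"
      using that inj by (auto simp: le_less inj_on_def)
    then show ?thesis using fin by (simp add: l_def)
  qed
  have le1: "l i + w i \<le> 1" if "i \<in> V" for i
    unfolding r[OF that] sum[symmetric] by (rule mono) auto
  have ge0: "0 \<le> l i" for i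
    unfolding l_def by (intro sum_nonneg) (auto intro: less_imp_le w)
  have less: "l i + w i \<le> l j" if "i \<in> V" "j \<in> V" "g i < g j" for i j
    unfolding r[OF that(1)] unfolding l_def by (rule mono) (use that in auto)
  have "disjoint_family_on (cell w l) V"
  proof (unfold disjoint_family_on_def, intro ballI impI)
    fix i j assume ij: "i \<in> V" "j \<in> V" "i \<noteq> j"
    then have "g i < g j \<or> g j < g i" using inj by (metis inj_on_def less_linear)
    then show "cell w l i \<inter> cell w l j = {}"
      using less[of i j] less[of j i] ij by (auto simp: cell_def)
  qed
  moreover have "(\<Union>i\<in>V. cell w l i) = {0..<1}"
  proof (intro equalityI subsetI)
    fix x assume "x \<in> (\<Union>i\<in>V. cell w l i)"
    then obtain i where "i \<in> V" "x \<in> cell w l i" by blast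
    then show "x \<in> {0..<1}" using le1[of i] ge0[of i] by (simp add: cell_def)
  next
    fix x :: real assume x: "x \<in> {0..<1}"
    \<comment> \<open>The cell containing \<open>x\<close> belongs to the least key in
      \<open>A\<close>. If it started beyond \<open>x\<close>, its predecessor, which ends where it
      starts, would also be in \<open>A\<close>.\<close>
    define A where "A = {i \<in> V. x < l i + w i}"
    have "V \<noteq> {}" using sum by auto
    have "A \<noteq> {}"
    proof -
      have "Max (g ` V) \<in> g ` V" using fin \<open>V \<noteq> {}\<close> by (intro Max_in) auto
      then obtain m where m: "m \<in> V" "g m = Max (g ` V)" by auto
      have "{j \<in> V. g j \<le> g m} = V" using m fin by auto
      then have "l m + w m = 1" using r[OF m(1)] sum by simp
      then show ?thesis using m x by (auto simp: A_def)
    qed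
    moreover have "finite A" using fin by (simp add: A_def)
    ultimately have "Min (g ` A) \<in> g ` A" by (intro Min_in) auto
    then obtain i where i: "i \<in> A" "g i = Min (g ` A)" by auto
    have least: "g i \<le> g j" if "j \<in> A" for j
      using that i \<open>finite A\<close> by simp
    have "l i \<le> x"
    proof (rule ccontr)
      assume "\<not> l i \<le> x"
      define D where "D = {j \<in> V. g j < g i}"
      have "D \<noteq> {}"
      proof
        assume "D = {}"
        then have "l i = 0" by (simp add: l_def D_def[symmetric])
        then show False using \<open>\<not> l i \<le> x\<close> x by simp
      qed
      moreover have "finite D" using fin by (simp add: D_def)
      ultimately have "Max (g ` D) \<in> g ` D" by (intro Max_in) auto
      then obtain m where m: "m \<in> D" "g m = Max (g ` D)" by auto
      have "{j \<in> V. g j \<le> g m} = D"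
      proof (intro equalityI subsetI)
        fix j assume "j \<in> {j \<in> V. g j \<le> g m}" then show "j \<in> D" using m by (auto simp: D_def)
      next
        fix j assume "j \<in> D"
        then have "g j \<le> g m" using m \<open>finite D\<close> by simp
        then show "j \<in> {j \<in> V. g j \<le> g m}" using \<open>j \<in> D\<close> by (auto simp: D_def)
      qed
      then have "l m + w m = l i" using r[of m] m by (simp add: D_def l_def)
      then have "m \<in> A" using \<open>\<not> l i \<le> x\<close> m by (simp add: A_def D_def)
      then show False using least[of m] m by (auto simp: D_def)
    qed
    then show "x \<in> (\<Union>i\<in>V. cell w l i)" using i by (auto simp: A_def cell_def)
  qed
  ultimately show ?thesis using fin w by (auto simp: tiling_def l_def[abs_def])
qed

lemma key_refining:
  fixes \<kappa> :: "'v \<Rightarrow> nat"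
  assumes "finite V"
  obtains g :: "'v \<Rightarrow> nat" where "inj_on g V" "\<And>i j. i \<in> V \<Longrightarrow> j \<in> V \<Longrightarrow> \<kappa> i < \<kappa> j \<Longrightarrow> g i < g j"
proof -
  obtain h :: "'v \<Rightarrow> nat" and n where h: "h ` V = {i. i < n}" "inj_on h V"
    using finite_imp_inj_to_nat_seg[OF assms] by metis
  \<comment> \<open>Lexicographic order coded in one number: \<open>h i < n\<close> only breaks
    ties.\<close>
  define g where "g i = \<kappa> i * n + h i" for i
  have hn: "h i < n" if "i \<in> V" for i using h(1) that by auto
  have less: "g i < g j" if "i \<in> V" "j \<in> V" "\<kappa> i < \<kappa> j" for i j
  proof -
    have "g i < Suc (\<kappa> i) * n" using hn[OF that(1)] by (simp add: g_def)
    also have "\<dots> \<le> \<kappa> j * n" using that by (intro mult_right_mono) auto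
    also have "\<dots> \<le> g j" by (simp add: g_def)
    finally show ?thesis .
  qed
  have "inj_on g V"
  proof (rule inj_onI)
    fix i j assume ij: "i \<in> V" "j \<in> V" "g i = g j"
    then have "\<kappa> i = \<kappa> j" using less[of i j] less[of j i] by (metis less_irrefl less_linear)
    then show "i = j" using ij h(2) by (simp add: g_def inj_on_def)
  qed
  then show ?thesis using that less by blast
qed

text \<open>Smaller labels come first, so all vertices with label below \<open>a\<close> together
  fill an initial interval. The label at a point is thus read off from block boundaries alone, which
  are numbers that can converge.\<close>

lemma class_le_iff:
  fixes \<kappa> :: "'v \<Rightarrow> nat" and g :: "'v \<Rightarrow> 'o::linorder"
  assumes fin: "finite V" and w: "\<And>i. i \<in> V \<Longrightarrow> 0 < w i" and inj: "inj_on g V"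
    and g: "\<And>i j. i \<in> V \<Longrightarrow> j \<in> V \<Longrightarrow> \<kappa> i < \<kappa> j \<Longrightarrow> g i < g j"
    and i: "i \<in> V" and x: "x \<in> cell w (\<lambda>i. \<Sum>j\<in>{j \<in> V. g j < g i}. w j) i"
  shows "a \<le> \<kappa> i \<longleftrightarrow> (\<Sum>j\<in>{j \<in> V. \<kappa> j < a}. w j) \<le> x"
proof -
  have mono: "sum w A \<le> sum w B" if "A \<subseteq> B" "B \<subseteq> V" for A B
    using that fin w by (intro sum_mono2) (auto intro: finite_subset less_imp_le)
  have "insert i {j \<in> V. g j < g i} = {j \<in> V. g j \<le> g i}"
    using i inj by (auto simp: le_less inj_on_def)
  moreover have "sum w (insert i {j \<in> V. g j < g i}) = sum w {j \<in> V. g j < g i} + w i"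
    using fin by simp
  ultimately have r: "sum w {j \<in> V. g j < g i} + w i = sum w {j \<in> V. g j \<le> g i}" by simp
  show ?thesis
  proof
    assume "a \<le> \<kappa> i"
    then have "(\<Sum>j\<in>{j \<in> V. \<kappa> j < a}. w j) \<le> sum w {j \<in> V. g j < g i}"
      using g[OF _ i] by (intro mono) auto
    then show "(\<Sum>j\<in>{j \<in> V. \<kappa> j < a}. w j) \<le> x" using x by (simp add: cell_def)
  next
    assume le: "(\<Sum>j\<in>{j \<in> V. \<kappa> j < a}. w j) \<le> x"
    show "a \<le> \<kappa> i"
    proof (rule ccontr)
      assume "\<not> a \<le> \<kappa> i"
      then have "sum w {j \<in> V. g j \<le> g i} \<le> (\<Sum>j\<in>{j \<in> V. \<kappa> j < a}. w j)"
        using g[OF i] by (intro mono) (auto simp: not_less[symmetric] intro: le_less_trans)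
      then show False using le x r by (simp add: cell_def)
    qed
  qed
qed

lemma emeasure_tiling:
  assumes t: "tiling V w l" and X: "X \<in> sets borel" "X \<subseteq> {0..1}"
  shows "emeasure lborel X = (\<Sum>i\<in>V. emeasure lborel (X \<inter> cell w l i))"
proof -
  have "emeasure lborel X = emeasure lborel (X \<inter> {0..<1})"
  proof (rule emeasure_eq_AE)
    show "AE x in lborel. x \<in> X \<longleftrightarrow> x \<in> X \<inter> {0..<1}"
      using AE_lborel_singleton[of "1::real"] X(2) by (auto elim!: eventually_mono)
  qed (use X in auto)
  also have "X \<inter> {0..<1} = (\<Union>i\<in>V. X \<inter> cell w l i)"
    using tilingD(4)[OF t] by auto
  also have "emeasure lborel \<dots> = (\<Sum>i\<in>V. emeasure lborel (X \<inter> cell w l i))"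
    using tilingD[OF t] X by (intro sum_emeasure[symmetric]) (auto simp: disjoint_family_on_def)
  finally show ?thesis .
qed

text \<open>\<open>\<sigma>\<close> translates each cell from its place in the first layout to its
  place in the second. It realises a change of vertex order as a rearrangement of the kind over
  which \<open>cut_dist\<close> takes its infimum.\<close>

lemma tiling_exchange:
  assumes t: "tiling V w l" and t': "tiling V w l'"
  obtains \<sigma> where "measure_preserving_bij \<sigma>"
    "\<And>x i. x \<in> {0..1} \<Longrightarrow> i \<in> V \<Longrightarrow> \<sigma> x \<in> cell w l' i \<longleftrightarrow> x \<in> cell w l i"
proof -
  define shift where "shift l l' x = x + (\<Sum>i\<in>V. indicator (cell w l i) x * (l' i - l i))"
    for l l' :: "'a \<Rightarrow> real" and x
  have cell: "shift l l' x = x + (l' i - l i)" "shift l l' x \<in> cell w l' i"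
    if "tiling V w l" "i \<in> V" "x \<in> cell w l i" for l l' i x
  proof -
    have "(\<Sum>j\<in>V. indicator (cell w l j) x * (l' j - l j)) = (\<Sum>j\<in>V. if j = i then l' i - l i else 0)"
    proof (rule sum.cong)
      fix j assume "j \<in> V"
      show "indicator (cell w l j) x * (l' j - l j) = (if j = i then l' i - l i else 0)"
      proof (cases "j = i")
        case True
        then show ?thesis using that(3) by simp
      next
        case False
        then have "x \<notin> cell w l j" using tilingD(6)[OF that(1) that(2) \<open>j \<in> V\<close> that(3)] by metis
        then show ?thesis using False by simp
      qed
    qed simp
    also have "\<dots> = l' i - l i" using that tilingD(1)[OF that(1)] by simp
    finally show "shift l l' x = x + (l' i - l i)" by (simp add: shift_def)
    then show "shift l l' x \<in> cell w l' i" using that(3) by (auto simp: cell_def)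
  qed
  \<comment> \<open>The end point \<open>1\<close> lies in no half-open cell, yet the bijection has
    to act on the closed interval.\<close>
  have one: "shift l l' 1 = 1" if "tiling V w l" for l l'
  proof -
    have "1 \<notin> cell w l i" if "i \<in> V" for i
      using tilingD(5)[OF \<open>tiling V w l\<close> that, of 1] by auto
    then have "(\<Sum>i\<in>V. indicator (cell w l i) 1 * (l' i - l i)) = 0" by (intro sum.neutral) auto
    then show ?thesis by (simp add: shift_def)
  qed
  have range: "shift l l' x \<in> {0..1}" "shift l' l (shift l l' x) = x"
    if u: "tiling V w l" "tiling V w l'" "x \<in> {0..1}" for l l' x
  proof -
    have "shift l l' x \<in> {0..1} \<and> shift l' l (shift l l' x) = x"
    proof (cases "x = 1")
      case True then show ?thesis using one that by simp
    next
      case False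
      then obtain i where i: "i \<in> V" "x \<in> cell w l i" using tiling_cell[OF u(1), of x] u(3) by auto
      note c = cell[OF u(1) i, of l']
      have "0 \<le> shift l l' x \<and> shift l l' x < 1" by (rule tilingD(5)[OF u(2) i(1) c(2)])
      moreover have "shift l' l (shift l l' x) = x"
        using cell(1)[OF u(2) i(1) c(2), of l] c(1) by simp
      ultimately show ?thesis by auto
    qed
    then show "shift l l' x \<in> {0..1}" "shift l' l (shift l l' x) = x" by auto
  qed
  define \<sigma> where "\<sigma> = shift l l'"
  have iff: "\<sigma> x \<in> cell w l' i \<longleftrightarrow> x \<in> cell w l i" if "x \<in> {0..1}" "i \<in> V" for x i
  proof
    assume "x \<in> cell w l i" then show "\<sigma> x \<in> cell w l' i" using cell(2)[OF t] that by (simp add: \<sigma>_def)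
  next
    assume "\<sigma> x \<in> cell w l' i"
    then have "shift l' l (\<sigma> x) \<in> cell w l i" using cell(2)[OF t'] that by simp
    then show "x \<in> cell w l i" using range(2)[OF t t' that(1)] by (simp add: \<sigma>_def)
  qed
  have bij: "bij_betw \<sigma> {0..1} {0..1}"
    by (rule bij_betw_byWitness[where f' = "shift l' l"])
      (use range[OF t t'] range[OF t' t] in \<open>auto simp: \<sigma>_def\<close>)
  have meas [measurable]: "\<sigma> \<in> borel_measurable borel"
    unfolding \<sigma>_def shift_def[abs_def] by measurable
  have sets_ui: "sets unit_interval = sets (restrict_space borel {0..1})"
    by (intro sets_restrict_space_cong) simp
  have meas': "\<sigma> \<in> measurable unit_interval unit_interval"
    by (intro measurable_restrict_space3) (use range[OF t t'] in \<open>auto simp: \<sigma>_def[symmetric]\<close>)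
  have "distr unit_interval unit_interval \<sigma> = unit_interval"
  proof (rule measure_eqI)
    fix A assume "A \<in> sets (distr unit_interval unit_interval \<sigma>)"
    then have A: "A \<in> sets borel" "A \<subseteq> {0..1}" and A': "A \<in> sets unit_interval"
      by (auto simp: sets_restrict_space_iff)
    have B: "\<sigma> -` A \<inter> {0..1} \<in> sets borel"
      using measurable_sets_borel[OF meas A(1)] by auto
    have "emeasure (distr unit_interval unit_interval \<sigma>) A
        = emeasure unit_interval (\<sigma> -` A \<inter> space unit_interval)"
      by (rule emeasure_distr[OF meas' A'])
    also have "\<dots> = emeasure lborel (\<sigma> -` A \<inter> {0..1})"
      by (simp add: space_restrict_space emeasure_restrict_space)
    also have "\<dots> = (\<Sum>i\<in>V. emeasure lborel (\<sigma> -` A \<inter> {0..1} \<inter> cell w l i))"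
      by (rule emeasure_tiling[OF t B]) auto
    also have "\<dots> = (\<Sum>i\<in>V. emeasure lborel (A \<inter> cell w l' i))"
    proof (rule sum.cong[OF refl])
      fix i assume i: "i \<in> V"
      have "\<sigma> -` A \<inter> {0..1} \<inter> cell w l i = (+) (l' i - l i) -` (A \<inter> cell w l' i)"
      proof (intro equalityI subsetI)
        fix x assume "x \<in> \<sigma> -` A \<inter> {0..1} \<inter> cell w l i"
        then show "x \<in> (+) (l' i - l i) -` (A \<inter> cell w l' i)"
          using cell[OF t i, of x l'] by (auto simp: \<sigma>_def add.commute)
      next
        fix x assume x: "x \<in> (+) (l' i - l i) -` (A \<inter> cell w l' i)"
        then have xc: "x \<in> cell w l i" by (auto simp: cell_def)
        then show "x \<in> \<sigma> -` A \<inter> {0..1} \<inter> cell w l i"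
          using cell(1)[OF t i xc, of l'] x tilingD(5)[OF t i xc] by (auto simp: \<sigma>_def add.commute)
      qed
      then have "emeasure lborel (\<sigma> -` A \<inter> {0..1} \<inter> cell w l i) =
          emeasure (distr lborel borel ((+) (l' i - l i))) (A \<inter> cell w l' i)"
        using A(1) by (subst emeasure_distr) auto
      then show "emeasure lborel (\<sigma> -` A \<inter> {0..1} \<inter> cell w l i) = emeasure lborel (A \<inter> cell w l' i)"
        by (simp add: lborel_distr_plus)
    qed
    also have "\<dots> = emeasure lborel A"
      by (rule emeasure_tiling[OF t' A, symmetric])
    also have "\<dots> = emeasure unit_interval A"
      using A by (simp add: emeasure_restrict_space)
    finally show "emeasure (distr unit_interval unit_interval \<sigma>) A = emeasure unit_interval A" .
  qed simp
  then have "measure_preserving_bij \<sigma>" using bij meas' by (simp add: measure_preserving_bij_def)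
  then show ?thesis using iff that by blast
qed

section \<open>Integrals and cut norms of step functions\<close>

definition step :: "'v set \<Rightarrow> ('v \<Rightarrow> real set) \<Rightarrow> ('v \<Rightarrow> 'v \<Rightarrow> real) \<Rightarrow> real \<times> real \<Rightarrow> real" where
  "step V J F = (\<lambda>(x, y). \<Sum>i\<in>V. \<Sum>j\<in>V. F i j * indicator (J i) x * indicator (J j) y)"

lemma step_cell:
  assumes t: "tiling V w l" and ij: "i \<in> V" "j \<in> V" "x \<in> cell w l i" "y \<in> cell w l j"
  shows "step V (cell w l) F (x, y) = F i j"
proof -
  have 1: "indicator (cell w l k) x = (if k = i then 1 else 0 :: real)"
    "indicator (cell w l k) y = (if k = j then 1 else 0 :: real)" if "k \<in> V" for k
  proof -
    have "x \<in> cell w l k \<longleftrightarrow> k = i" "y \<in> cell w l k \<longleftrightarrow> k = j"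
      using tilingD(6)[OF t ij(1) that ij(3)] tilingD(6)[OF t ij(2) that ij(4)] ij by metis+
    then show "indicator (cell w l k) x = (if k = i then 1 else 0 :: real)"
      "indicator (cell w l k) y = (if k = j then 1 else 0 :: real)"
      using ij by auto
  qed
  have "step V (cell w l) F (x, y) = (\<Sum>k\<in>V. \<Sum>m\<in>V. if k = i then if m = j then F i j else 0 else 0)"
    unfolding step_def by (auto intro!: sum.cong simp: 1)
  also have "\<dots> = (\<Sum>k\<in>V. if k = i then (\<Sum>m\<in>V. if m = j then F i j else 0) else 0)"
    by (intro sum.cong) auto
  also have "\<dots> = F i j" using ij tilingD(1)[OF t] by simp
  finally show ?thesis .
qed

lemma step_outside:
  assumes t: "tiling V w l" and "x \<notin> {0..<1} \<or> y \<notin> {0..<1}"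
  shows "step V (cell w l) F (x, y) = 0"
proof -
  have "indicator (cell w l i) x * indicator (cell w l j) y = (0::real)" if "i \<in> V" "j \<in> V" for i j
    using tilingD(5)[OF t that(1), of x] tilingD(5)[OF t that(2), of y] assms(2)
    by (auto simp: indicator_def)
  then show ?thesis by (auto simp: step_def mult.assoc intro!: sum.neutral)
qed

text \<open>On products of cells both functions are constant; off them both vanish, whence
  \<open>h 0 0 = 0\<close>. With this convention integrals may run over the whole plane.\<close>

lemma step_comp:
  assumes t: "tiling V w l" and "h 0 0 = 0"
  shows "h (step V (cell w l) F z) (step V (cell w l) F' z)
    = step V (cell w l) (\<lambda>i j. h (F i j) (F' i j)) z"
proof (cases z)
  case (Pair x y)
  show ?thesis
  proof (cases "x \<in> {0..<1} \<and> y \<in> {0..<1}")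
    case True
    then obtain i j where "i \<in> V" "x \<in> cell w l i" "j \<in> V" "y \<in> cell w l j"
      using tiling_cell[OF t, of x] tiling_cell[OF t, of y] by (metis atLeastLessThan_iff)
    then show ?thesis by (simp add: Pair step_cell[OF t])
  next
    case False
    then show ?thesis using assms(2) step_outside[OF t, of x y] by (simp add: Pair)
  qed
qed

lemma emeasure_lborel_Times:
  fixes A B :: "real set"
  assumes "A \<in> sets borel" "B \<in> sets borel"
  shows "emeasure lborel (A \<times> B) = emeasure lborel A * emeasure lborel B"
  unfolding lborel_prod[symmetric] using assms
  by (subst lborel.emeasure_pair_measure_Times) auto

lemma measurable_Times_borel:
  fixes A B :: "real set"
  assumes "A \<in> sets borel" "B \<in> sets borel"
  shows "A \<times> B \<in> sets (borel :: (real \<times> real) measure)"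
  unfolding borel_prod[symmetric] using assms by (intro pair_measureI) auto

lemma has_integral_step:
  assumes t: "tiling V w l" and S: "S \<in> sets borel" and T: "T \<in> sets borel"
  shows "has_bochner_integral lborel (\<lambda>z. indicator (S \<times> T) z *\<^sub>R step V (cell w l) F z)
    (\<Sum>i\<in>V. \<Sum>j\<in>V. F i j * (measure lborel (S \<inter> cell w l i) * measure lborel (T \<inter> cell w l j)))"
proof -
  have eq: "(\<lambda>z. indicator (S \<times> T) z *\<^sub>R step V (cell w l) F z) =
    (\<lambda>z. \<Sum>i\<in>V. \<Sum>j\<in>V. F i j * indicator ((S \<inter> cell w l i) \<times> (T \<inter> cell w l j)) z)"
    by (auto simp: step_def fun_eq_iff sum_distrib_left indicator_def intro!: sum.cong)
  show ?thesis unfolding eq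
  proof (intro has_bochner_integral_sum has_bochner_integral_mult_right)
    fix i j assume "i \<in> V" "j \<in> V"
    let ?A = "S \<inter> cell w l i" and ?B = "T \<inter> cell w l j"
    have AB: "?A \<in> sets borel" "?B \<in> sets borel" using S T by auto
    have fin: "emeasure lborel ?A < \<infinity>" "emeasure lborel ?B < \<infinity>"
      using tilingD(2)[OF t \<open>i \<in> V\<close>] tilingD(2)[OF t \<open>j \<in> V\<close>]
        emeasure_mono[of ?A "cell w l i" lborel] emeasure_mono[of ?B "cell w l j" lborel]
      by (auto simp: cell_def intro: le_less_trans[OF _ ennreal_less_top])
    have "has_bochner_integral lborel (indicator (?A \<times> ?B)) (measure lborel (?A \<times> ?B))"
      using AB fin by (intro has_bochner_integral_real_indicator)
        (auto simp: emeasure_lborel_Times measurable_Times_borel ennreal_mult_less_top)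
    also have "measure lborel (?A \<times> ?B) = measure lborel ?A * measure lborel ?B"
      using AB by (simp add: measure_def emeasure_lborel_Times enn2real_mult)
    finally show "has_bochner_integral lborel (indicator (?A \<times> ?B)) (measure lborel ?A * measure lborel ?B)" .
  qed
qed

lemma has_integral_step_UNIV:
  assumes t: "tiling V w l"
  shows "has_bochner_integral lborel (step V (cell w l) F) (\<Sum>i\<in>V. \<Sum>j\<in>V. w i * w j * F i j)"
proof -
  have "measure lborel (cell w l i) = w i" if "i \<in> V" for i
    using tilingD(2)[OF t that] by (simp add: cell_def)
  then show ?thesis
    using has_integral_step[OF t, of UNIV UNIV F] by (simp add: mult_ac cong: sum.cong)
qed

context kernel
begin

lemma integral_step:
  assumes t: "tiling V w l" and "h 0 0 = 0"
  shows "has_bochner_integral lborel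
     (\<lambda>z. h (step V (cell w l) F z) (step V (cell w l) F' z)) (mean (\<lambda>i j. h (F i j) (F' i j)))"
  unfolding step_comp[OF t, where h = h, OF assms(2)] mean_def by (rule has_integral_step_UNIV[OF t])

lemma cut_integral_step:
  assumes t: "tiling V w l" and S: "S \<in> sets borel" and T: "T \<in> sets borel"
    and D: "\<And>S T. S \<subseteq> V \<Longrightarrow> T \<subseteq> V \<Longrightarrow> \<bar>\<Sum>i\<in>S. \<Sum>j\<in>T. w i * w j * F i j\<bar> \<le> D"
  shows "\<bar>LINT z:S \<times> T|lborel. step V (cell w l) F z\<bar> \<le> D"
proof -
  \<comment> \<open>The fraction of the cell covered by the set, to be used as a fractional vertex
    set.\<close>
  define f where "f S i = measure lborel (S \<inter> cell w l i) / w i" for S i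
  have f: "0 \<le> f S i \<and> f S i \<le> 1" if "i \<in> V" "S \<in> sets borel" for S i
  proof -
    have "measure lborel (S \<inter> cell w l i) \<le> measure lborel (cell w l i)"
      using tilingD(2)[OF t that(1)] that(2)
      by (intro measure_mono_fmeasurable) (auto simp: cell_def fmeasurable_def)
    also have "\<dots> = w i" using tilingD(2)[OF t that(1)] by (simp add: cell_def)
    finally show ?thesis using tilingD(2)[OF t that(1)] by (simp add: f_def)
  qed
  have "(LINT z:S \<times> T|lborel. step V (cell w l) F z) = (\<Sum>i\<in>V. \<Sum>j\<in>V. F i j *
      (measure lborel (S \<inter> cell w l i) * measure lborel (T \<inter> cell w l j)))"
    unfolding set_lebesgue_integral_def
    by (rule has_bochner_integral_integral_eq[OF has_integral_step[OF t S T]])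
  also have "\<dots> = (\<Sum>i\<in>V. \<Sum>j\<in>V. f S i * f T j * (w i * w j * F i j))"
    using tilingD(2)[OF t] by (intro sum.cong refl) (auto simp: f_def field_simps less_imp_neq[symmetric])
  also have "\<bar>\<dots>\<bar> \<le> D"
    by (rule fractional_double_sum_le[OF finite_V f f D]) (use S T in auto)
  finally show ?thesis .
qed

text \<open>\<open>R - W\<close> is split at the step function of \<open>F\<close>: vertex-set
  discrepancy bounds the first part, the L1 norm the second. \<open>R\<close> is prescribed on the
  unit square only because a rearranged graphon is controlled only there.\<close>

lemma cut_norm_le:
  assumes t: "tiling V w l"
    and D: "\<And>S T. S \<subseteq> V \<Longrightarrow> T \<subseteq> V \<Longrightarrow> \<bar>\<Sum>i\<in>S. \<Sum>j\<in>T. w i * w j * (\<beta> i j - F i j)\<bar> \<le> D"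
    and W: "integrable lborel W"
    and R: "\<And>z. z \<in> unit_square \<Longrightarrow> R z = step V (cell w l) \<beta> z"
  shows "cut_norm (\<lambda>z. R z - W z) \<le> ereal (D + (LINT z|lborel. \<bar>step V (cell w l) F z - W z\<bar>))"
  unfolding cut_norm_def
proof (intro SUP_least, clarsimp)
  fix S T :: "real set"
  assume S: "S \<in> sets borel" "S \<subseteq> {0..1}" and T: "T \<in> sets borel" "T \<subseteq> {0..1}"
  let ?U = "step V (cell w l) F"
  have ST [measurable]: "S \<times> T \<in> sets borel" using S T by (simp add: measurable_Times_borel)
  have i1: "set_integrable lborel (S \<times> T) (step V (cell w l) G)" for G
    using has_integral_step[OF t S(1) T(1)] unfolding set_integrable_def by (auto simp: has_bochner_integral_iff)
  have iU: "integrable lborel ?U"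
    using has_integral_step_UNIV[OF t] by (auto simp: has_bochner_integral_iff)
  have i2: "integrable lborel (\<lambda>z. ?U z - W z)" using iU W by simp
  have i2': "set_integrable lborel (S \<times> T) (\<lambda>z. ?U z - W z)"
    unfolding set_integrable_def by (rule integrable_mult_indicator[OF _ i2]) simp
  have "(LINT z:S \<times> T|lborel. R z - W z) =
      (LINT z:S \<times> T|lborel. step V (cell w l) (\<lambda>i j. \<beta> i j - F i j) z + (?U z - W z))"
  proof (rule set_lebesgue_integral_cong)
    show "\<forall>z. z \<in> S \<times> T \<longrightarrow> R z - W z = step V (cell w l) (\<lambda>i j. \<beta> i j - F i j) z + (?U z - W z)"
    proof (intro allI impI)
      fix z assume "z \<in> S \<times> T"
      then have "R z = step V (cell w l) \<beta> z" using S T by (intro R) auto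
      moreover have "step V (cell w l) (\<lambda>i j. \<beta> i j - F i j) z = step V (cell w l) \<beta> z - ?U z"
        by (rule step_comp[OF t, where h = "(-)", symmetric]) simp
      ultimately show "R z - W z = step V (cell w l) (\<lambda>i j. \<beta> i j - F i j) z + (?U z - W z)" by simp
    qed
  qed simp
  also have "\<dots> = (LINT z:S \<times> T|lborel. step V (cell w l) (\<lambda>i j. \<beta> i j - F i j) z)
      + (LINT z:S \<times> T|lborel. ?U z - W z)"
    by (rule set_integral_add(2)[OF i1 i2'])
  also have "\<bar>\<dots>\<bar> \<le> D + (LINT z|lborel. \<bar>?U z - W z\<bar>)"
  proof (rule order_trans[OF abs_triangle_ineq add_mono])
    show "\<bar>LINT z:S \<times> T|lborel. step V (cell w l) (\<lambda>i j. \<beta> i j - F i j) z\<bar> \<le> D"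
      by (rule cut_integral_step[OF t S(1) T(1) D])
    have "\<bar>LINT z:S \<times> T|lborel. ?U z - W z\<bar> \<le> (LINT z|lborel. \<bar>indicator (S \<times> T) z *\<^sub>R (?U z - W z)\<bar>)"
      unfolding set_lebesgue_integral_def by (rule integral_abs_bound)
    also have "\<dots> \<le> (LINT z|lborel. \<bar>?U z - W z\<bar>)"
    proof (rule integral_mono)
      show "integrable lborel (\<lambda>z. \<bar>indicator (S \<times> T) z *\<^sub>R (?U z - W z)\<bar>)"
        using i2' unfolding set_integrable_def by (rule integrable_abs)
      show "integrable lborel (\<lambda>z. \<bar>?U z - W z\<bar>)" using i2 by (rule integrable_abs)
    qed (auto simp: indicator_def)
    finally show "\<bar>LINT z:S \<times> T|lborel. ?U z - W z\<bar> \<le> (LINT z|lborel. \<bar>?U z - W z\<bar>)" .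
  qed
  finally show "\<bar>LINT z:S \<times> T|lborel. R z - W z\<bar> \<le> D + (LINT z|lborel. \<bar>?U z - W z\<bar>)" .
qed

end

section \<open>Limits in L1 and of moments\<close>

lemma AE_summable_of_summable_integral:
  fixes g :: "nat \<Rightarrow> 'a \<Rightarrow> real"
  assumes int: "\<And>n. integrable M (g n)" and sum: "summable (\<lambda>n. LINT x|M. \<bar>g n x\<bar>)"
  shows "AE x in M. summable (\<lambda>n. \<bar>g n x\<bar>)"
proof -
  have [measurable]: "g n \<in> borel_measurable M" for n using int by auto
  have "(\<integral>\<^sup>+x. (\<Sum>n. ennreal \<bar>g n x\<bar>) \<partial>M) = (\<Sum>n. \<integral>\<^sup>+x. ennreal \<bar>g n x\<bar> \<partial>M)"
    by (rule nn_integral_suminf) measurable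
  also have "\<dots> = (\<Sum>n. ennreal (LINT x|M. \<bar>g n x\<bar>))"
    using int by (intro suminf_cong nn_integral_eq_integral) auto
  also have "\<dots> \<noteq> \<infinity>"
    using sum by (simp add: suminf_ennreal_eq[OF _ summable_sums])
  finally have "AE x in M. (\<Sum>n. ennreal \<bar>g n x\<bar>) \<noteq> \<infinity>"
    by (intro nn_integral_PInf_AE) auto
  then show ?thesis
    by (rule eventually_mono) (auto intro: summable_suminf_not_top)
qed

text \<open>The Riesz-Fischer argument: the telescoping series converges absolutely almost
  everywhere, and \<open>G\<close> dominates the sequence. The limit is named as a pointwise
  \<open>lim\<close> so that the symmetry of the terms can be transferred to it at every
  point.\<close>

lemma L1_fast_Cauchy_limit:
  fixes f :: "nat \<Rightarrow> 'a \<Rightarrow> real"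
  assumes int: "\<And>n. integrable M (f n)" and fast: "\<And>n. (LINT x|M. \<bar>f (Suc n) x - f n x\<bar>) \<le> (1 / 2) ^ n"
  shows "AE x in M. (\<lambda>n. f n x) \<longlonglongrightarrow> lim (\<lambda>n. f n x)"
    and "integrable M (\<lambda>x. lim (\<lambda>n. f n x))"
    and "(\<lambda>n. LINT x|M. \<bar>f n x - lim (\<lambda>n. f n x)\<bar>) \<longlonglongrightarrow> 0"
proof -
  have [measurable]: "f n \<in> borel_measurable M" for n using int by auto
  define g where "g n x = f (Suc n) x - f n x" for n x
  have gint: "integrable M (g n)" for n unfolding g_def[abs_def] using int by simp
  have gsum: "summable (\<lambda>n. LINT x|M. \<bar>g n x\<bar>)"
    by (rule summable_comparison_test'[OF summable_geometric[of "1/2 :: real"], where N = 0])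
      (use fast in \<open>auto simp: g_def\<close>)
  have AEs: "AE x in M. summable (\<lambda>n. \<bar>g n x\<bar>)"
    by (rule AE_summable_of_summable_integral[OF gint gsum])
  define G where "G x = \<bar>f 0 x\<bar> + (\<Sum>n. \<bar>g n x\<bar>)" for x
  have "integrable M (\<lambda>x. \<Sum>n. \<bar>g n x\<bar>)"
    using AEs gsum by (intro integrable_suminf integrable_abs gint) auto
  then have Gint: "integrable M G" unfolding G_def[abs_def]
    by (intro Bochner_Integration.integrable_add integrable_abs int)
  have fsum: "f n x = f 0 x + (\<Sum>i<n. g i x)" for n x
    by (induction n) (auto simp: g_def)
  have bound: "AE x in M. norm (f n x) \<le> G x" for n
    using AEs
  proof eventually_elim
    case (elim x)
    have "\<bar>f n x\<bar> \<le> \<bar>f 0 x\<bar> + (\<Sum>i<n. \<bar>g i x\<bar>)"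
      unfolding fsum[of n] by (intro order_trans[OF abs_triangle_ineq] add_left_mono sum_abs)
    also have "\<dots> \<le> G x" unfolding G_def
      using elim by (intro add_left_mono sum_le_suminf) auto
    finally show ?case by simp
  qed
  show conv: "AE x in M. (\<lambda>n. f n x) \<longlonglongrightarrow> lim (\<lambda>n. f n x)"
    using AEs
  proof eventually_elim
    case (elim x)
    have "summable (\<lambda>n. g n x)" using elim by (rule summable_rabs_cancel)
    then have "(\<lambda>n. f 0 x + (\<Sum>i<n. g i x)) \<longlonglongrightarrow> f 0 x + (\<Sum>n. g n x)"
      by (intro tendsto_add tendsto_const summable_LIMSEQ)
    then have "convergent (\<lambda>n. f n x)" unfolding fsum[symmetric] by (rule convergentI)
    then show ?case by (simp add: convergent_LIMSEQ_iff)
  qed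
  have [measurable]: "(\<lambda>x. lim (\<lambda>n. f n x)) \<in> borel_measurable M" by measurable
  show lint: "integrable M (\<lambda>x. lim (\<lambda>n. f n x))"
    by (rule integrable_dominated_convergence[OF _ _ Gint conv bound]) auto
  have "(\<lambda>n. LINT x|M. \<bar>f n x - lim (\<lambda>n. f n x)\<bar>) \<longlonglongrightarrow> (LINT x|M. 0)"
  proof (rule integral_dominated_convergence)
    show "integrable M (\<lambda>x. G x + \<bar>lim (\<lambda>n. f n x)\<bar>)" using Gint lint by simp
    show "AE x in M. (\<lambda>n. \<bar>f n x - lim (\<lambda>n. f n x)\<bar>) \<longlonglongrightarrow> 0"
      using conv by eventually_elim (simp add: tendsto_rabs_zero_iff LIM_zero_iff)
    show "AE x in M. norm \<bar>f n x - lim (\<lambda>n. f n x)\<bar> \<le> G x + \<bar>lim (\<lambda>n. f n x)\<bar>" for n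
      using bound[of n] by eventually_elim simp
  qed auto
  then show "(\<lambda>n. LINT x|M. \<bar>f n x - lim (\<lambda>n. f n x)\<bar>) \<longlonglongrightarrow> 0" by simp
qed

text \<open>Fatou's lemma; convergence almost everywhere is enough to pass moment bounds to the
  limit.\<close>

lemma nn_integral_powr_AE_limit_le:
  fixes f :: "nat \<Rightarrow> 'a \<Rightarrow> real"
  assumes [measurable]: "\<And>n. f n \<in> borel_measurable M"
    and conv: "AE x in M. (\<lambda>n. f n x) \<longlonglongrightarrow> F x" and p: "0 < p"
    and le: "\<And>n. (\<integral>\<^sup>+x. ennreal (\<bar>f n x\<bar> powr p) \<partial>M) \<le> ennreal (c n)" and c: "c \<longlonglongrightarrow> L"
  shows "(\<integral>\<^sup>+x. ennreal (\<bar>F x\<bar> powr p) \<partial>M) \<le> ennreal L"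
proof -
  have "(\<integral>\<^sup>+x. ennreal (\<bar>F x\<bar> powr p) \<partial>M) = (\<integral>\<^sup>+x. liminf (\<lambda>n. ennreal (\<bar>f n x\<bar> powr p)) \<partial>M)"
  proof (rule nn_integral_cong_AE)
    show "AE x in M. ennreal (\<bar>F x\<bar> powr p) = liminf (\<lambda>n. ennreal (\<bar>f n x\<bar> powr p))"
      using conv
    proof eventually_elim
      case (elim x)
      have "(\<lambda>n. \<bar>f n x\<bar> powr p) \<longlonglongrightarrow> \<bar>F x\<bar> powr p"
        using p by (intro tendsto_powr2 tendsto_rabs elim tendsto_const) auto
      then have "(\<lambda>n. ennreal (\<bar>f n x\<bar> powr p)) \<longlonglongrightarrow> ennreal (\<bar>F x\<bar> powr p)"
        by (rule tendsto_ennrealI)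
      then show ?case using lim_imp_Liminf[OF sequentially_bot] by metis
    qed
  qed
  also have "\<dots> \<le> liminf (\<lambda>n. \<integral>\<^sup>+x. ennreal (\<bar>f n x\<bar> powr p) \<partial>M)"
    by (rule nn_integral_liminf) measurable
  also have "\<dots> \<le> liminf (\<lambda>n. ennreal (c n))"
    using le by (intro Liminf_mono always_eventually allI) auto
  also have "\<dots> = ennreal L"
    using c by (intro lim_imp_Liminf tendsto_ennrealI) auto
  finally show ?thesis .
qed

lemma AE_lborel_pair_notin:
  fixes N :: "real set"
  assumes "countable N"
  shows "AE z in lborel. fst z \<notin> N \<and> snd z \<notin> N"
proof -
  have N: "N \<in> sets borel" "emeasure lborel N = 0"
    using assms by (auto intro: sets.countable emeasure_lborel_countable)
  have "N \<times> UNIV \<union> UNIV \<times> N \<in> null_sets (lborel :: (real \<times> real) measure)"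
    using N by (intro null_sets.Un null_setsI)
      (auto simp: emeasure_lborel_Times measurable_Times_borel)
  then show ?thesis by (rule AE_I') auto
qed

section \<open>Limits of block averages\<close>

lemma bounded_family_convergent_subsequence:
  fixes f :: "nat \<Rightarrow> 'i::countable \<Rightarrow> real"
  assumes bound: "\<And>n i. \<bar>f n i\<bar> \<le> c"
  obtains r where "strict_mono r" "\<And>i. convergent (\<lambda>n. f (r n) i)"
proof -
  interpret subseqs "\<lambda>k r. convergent (\<lambda>n. f (r n) (from_nat k))"
  proof
    fix k and r :: "nat \<Rightarrow> nat"
    have "bounded (range (\<lambda>n. f (r n) (from_nat k)))"
      using bound by (auto simp: bounded_iff)
    then obtain l r' where "strict_mono r'" "((\<lambda>n. f (r n) (from_nat k)) \<circ> r') \<longlonglongrightarrow> l"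
      using bounded_imp_convergent_subsequence by blast
    then show "\<exists>r'. strict_mono r' \<and> convergent (\<lambda>n. f ((r \<circ> r') n) (from_nat k))"
      by (auto simp: convergent_def o_def)
  qed
  \<comment> \<open>From position \<open>Suc k\<close> on, the diagonal sequence is a subsequence of
    the one chosen for index \<open>k\<close>.\<close>
  have "convergent (\<lambda>n. f ((diagseq \<circ> (+) (Suc k)) n) (from_nat k))" for k
  proof (rule diagseq_holds)
    fix m and s r :: "nat \<Rightarrow> nat"
    assume "strict_mono r" "convergent (\<lambda>n. f (s n) (from_nat m))"
    then show "convergent (\<lambda>n. f ((s \<circ> r) n) (from_nat m))"
      using convergent_subseq_convergent[of "\<lambda>n. f (s n) (from_nat m)" r] by (simp add: o_def)
  qed
  then have "convergent (\<lambda>n. f ((diagseq \<circ> (+) (Suc (to_nat i))) n) (from_nat (to_nat i)))" for i :: 'i .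
  then have "convergent (\<lambda>n. f (diagseq (n + Suc (to_nat i))) (from_nat (to_nat i)))" for i :: 'i
    unfolding comp_apply add.commute[of "Suc _"] .
  then have "convergent (\<lambda>n. f (diagseq (n + Suc (to_nat i))) i)" for i
    unfolding from_nat_to_nat .
  then have "convergent (\<lambda>n. f (diagseq n) i)" for i
    using convergent_ignore_initial_segment[of "\<lambda>n. f (diagseq n) i" "Suc (to_nat i)"] by blast
  then show ?thesis using that subseq_diagseq by blast
qed

text \<open>
  The key \<open>g n\<close> refines the finest labelling \<open>\<kappa> n n\<close>, hence all coarser ones. Ordering the vertices
  by this key therefore turns the blocks of all levels into intervals, whose left endpoints are
  the numbers \<open>s n k a\<close> below.
\<close>

locale kernel_seq =
  fixes V :: "nat \<Rightarrow> 'v set" and w :: "nat \<Rightarrow> 'v \<Rightarrow> real" and \<beta> :: "nat \<Rightarrow> 'v \<Rightarrow> 'v \<Rightarrow> real"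
    and \<kappa> :: "nat \<Rightarrow> nat \<Rightarrow> 'v \<Rightarrow> nat" and g :: "nat \<Rightarrow> 'v \<Rightarrow> nat" and q B :: real
  assumes kernel: "kernel (V n) (w n) (\<beta> n)"
    and refine: "k < n \<Longrightarrow> i \<in> V n \<Longrightarrow> \<kappa> n (Suc k) i div 4 = \<kappa> n k i"
    and label_less: "k \<le> n \<Longrightarrow> i \<in> V n \<Longrightarrow> \<kappa> n k i < 4 ^ k"
    and block_large: "k \<le> n \<Longrightarrow> a < 4 ^ k \<Longrightarrow> 1 / 16 ^ k \<le> sum (w n) (kernel.block (V n) (\<kappa> n k) a)"
    and key_inj: "inj_on (g n) (V n)"
    and key_less: "i \<in> V n \<Longrightarrow> j \<in> V n \<Longrightarrow> \<kappa> n n i < \<kappa> n n j \<Longrightarrow> g n i < g n j"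
    and q: "1 < q"
    and moment: "k \<le> n \<Longrightarrow> kernel.mean (V n) (w n)
      (\<lambda>i j. \<bar>kernel.avg (V n) (w n) (\<beta> n) (\<kappa> n k) (\<kappa> n k i) (\<kappa> n k j)\<bar> powr q) \<le> B"
begin

definition d :: "nat \<Rightarrow> nat \<Rightarrow> nat \<Rightarrow> nat \<Rightarrow> real" where
  "d n k = kernel.avg (V n) (w n) (\<beta> n) (\<kappa> n k)"

definition e :: "nat \<Rightarrow> nat \<Rightarrow> real" where
  "e n k = kernel.energy (V n) (w n) (\<beta> n) (\<kappa> n k)"

definition s :: "nat \<Rightarrow> nat \<Rightarrow> nat \<Rightarrow> real" where
  "s n k a = (\<Sum>j\<in>{j \<in> V n. \<kappa> n k j < a}. w n j)"

definition left :: "nat \<Rightarrow> 'v \<Rightarrow> real" where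
  "left n i = (\<Sum>j\<in>{j \<in> V n. g n j < g n i}. w n j)"

abbreviation J :: "nat \<Rightarrow> 'v \<Rightarrow> real set" where
  "J n \<equiv> cell (w n) (left n)"

definition U :: "nat \<Rightarrow> nat \<Rightarrow> real \<times> real \<Rightarrow> real" where
  "U n k = step (V n) (J n) (\<lambda>i j. d n k (\<kappa> n k i) (\<kappa> n k j))"

lemma tile: "tiling (V n) (w n) (left n)"
proof -
  interpret kernel "V n" "w n" "\<beta> n" by (rule kernel)
  show ?thesis unfolding left_def[abs_def]
    by (rule tiling_of_key[OF finite_V w_pos sum_w key_inj])
qed

lemma coarser: "k + m \<le> n \<Longrightarrow> i \<in> V n \<Longrightarrow> \<kappa> n k i = \<kappa> n (k + m) i div 4 ^ m"
proof (induction m)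
  case (Suc m)
  then have "\<kappa> n k i = (\<kappa> n (Suc (k + m)) i div 4) div 4 ^ m"
    using refine[of "k + m" n i] by simp
  then show ?case by (simp add: div_mult2_eq[symmetric])
qed simp

lemma coarser': "k \<le> k' \<Longrightarrow> k' \<le> n \<Longrightarrow> i \<in> V n \<Longrightarrow> \<kappa> n k i = \<kappa> n k' i div 4 ^ (k' - k)"
  using coarser[of k "k' - k" n i] by simp

lemma label_le_iff:
  assumes "k \<le> n" "i \<in> V n" "x \<in> J n i"
  shows "a \<le> \<kappa> n k i \<longleftrightarrow> s n k a \<le> x"
proof -
  interpret kernel "V n" "w n" "\<beta> n" by (rule kernel)
  \<comment> \<open>The key respects the finest labels. Coarser ones arise by the monotone map
    \<open>div\<close>, so a strict coarse inequality forces a strict fine one.\<close>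
  have "g n i < g n j" if "i \<in> V n" "j \<in> V n" "\<kappa> n k i < \<kappa> n k j" for i j
  proof (rule key_less[OF that(1,2)], rule ccontr)
    assume "\<not> \<kappa> n n i < \<kappa> n n j"
    then have "\<kappa> n n j div 4 ^ (n - k) \<le> \<kappa> n n i div 4 ^ (n - k)" by (intro div_le_mono) simp
    then show False using that coarser'[OF assms(1) order_refl] by simp
  qed
  then show ?thesis
    unfolding s_def using assms(3) unfolding left_def[abs_def]
    by (intro class_le_iff[OF finite_V w_pos key_inj _ assms(2)])
qed

lemma U_integrable: "integrable lborel (U n k)"
  using has_integral_step_UNIV[OF tile] unfolding U_def by (auto simp: has_bochner_integral_iff)

lemma U_measurable [measurable]: "U n k \<in> borel_measurable borel"
  using U_integrable[of n k] by auto

lemma U_outside: "x \<notin> {0..<1} \<or> y \<notin> {0..<1} \<Longrightarrow> U n k (x, y) = 0"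
  unfolding U_def by (rule step_outside[OF tile])

lemma U_cell: "i \<in> V n \<Longrightarrow> j \<in> V n \<Longrightarrow> x \<in> J n i \<Longrightarrow> y \<in> J n j \<Longrightarrow>
    U n k (x, y) = d n k (\<kappa> n k i) (\<kappa> n k j)"
  unfolding U_def by (rule step_cell[OF tile])

lemma U_sym: "U n k (x, y) = U n k (y, x)"
proof -
  interpret kernel "V n" "w n" "\<beta> n" by (rule kernel)
  show ?thesis unfolding U_def step_def d_def
    by (simp, subst sum.swap, intro sum.cong refl, subst avg_sym) simp
qed

lemma d_le:
  assumes "k \<le> n" "a < 4 ^ k" "b < 4 ^ k"
  shows "\<bar>d n k a b\<bar> \<le> 256 ^ k"
proof -
  interpret kernel "V n" "w n" "\<beta> n" by (rule kernel)
  have "\<bar>d n k a b\<bar> \<le> 1 / (1 / 16 ^ k)\<^sup>2"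
    unfolding d_def by (rule abs_avg_le) (use assms block_large in auto)
  also have "\<dots> = (16\<^sup>2) ^ k" unfolding power_divide power_mult[symmetric] by (simp add: mult.commute)
  finally show ?thesis by simp
qed

lemma U_le:
  assumes "k \<le> n"
  shows "\<bar>U n k z\<bar> \<le> 256 ^ k * indicator unit_square z"
proof (cases z)
  case (Pair x y)
  show ?thesis
  proof (cases "x \<in> {0..<1} \<and> y \<in> {0..<1}")
    case True
    then obtain i j where ij: "i \<in> V n" "x \<in> J n i" "j \<in> V n" "y \<in> J n j"
      using tiling_cell[OF tile, of x n] tiling_cell[OF tile, of y n] by (metis atLeastLessThan_iff)
    have "\<bar>U n k z\<bar> \<le> 256 ^ k"
      using ij assms label_less d_le by (simp add: Pair U_cell)
    then show ?thesis using True by (simp add: Pair indicator_def)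
  next
    case False
    then show ?thesis using U_outside[of x y n k] by (simp add: Pair)
  qed
qed

lemma U_dist:
  "has_bochner_integral lborel (\<lambda>z. \<bar>U n k z - U n m z\<bar>) (kernel.mean (V n) (w n)
    (\<lambda>i j. \<bar>d n k (\<kappa> n k i) (\<kappa> n k j) - d n m (\<kappa> n m i) (\<kappa> n m j)\<bar>))"
proof -
  interpret kernel "V n" "w n" "\<beta> n" by (rule kernel)
  show ?thesis unfolding U_def
    by (rule integral_step[OF tile, where h = "\<lambda>x y. \<bar>x - y\<bar>"]) simp
qed

lemma U_dist_energy:
  assumes "k \<le> m" "m \<le> n" "0 < \<epsilon>" "1 \<le> M"
  shows "(LINT z|lborel. \<bar>U n m z - U n k z\<bar>) \<le> \<epsilon> + M ^ 3 / (2 * \<epsilon>) * (e n m - e n k)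
    + 2 * 2 powr q * M powr (1 - q) * (2 + B + B)"
proof -
  interpret kernel "V n" "w n" "\<beta> n" by (rule kernel)
  have "(LINT z|lborel. \<bar>U n m z - U n k z\<bar>) = mean
    (\<lambda>i j. \<bar>d n m (\<kappa> n m i) (\<kappa> n m j) - d n k (\<kappa> n k i) (\<kappa> n k j)\<bar>)"
    by (rule has_bochner_integral_integral_eq[OF U_dist])
  also have "\<dots> \<le> \<epsilon> + M ^ 3 / (2 * \<epsilon>) * (e n m - e n k)
    + 2 * 2 powr q * M powr (1 - q) * (2 + B + B)"
    unfolding d_def e_def
    by (rule mean_diff_le_energy_diff[where f = "\<lambda>a. a div 4 ^ (m - k)"])
      (use assms coarser'[OF assms(1,2)] q moment in auto)
  finally show ?thesis .
qed

lemma e_bounds: "0 \<le> e n k" "e n k \<le> 2"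
proof -
  interpret kernel "V n" "w n" "\<beta> n" by (rule kernel)
  show "0 \<le> e n k" "e n k \<le> 2" unfolding e_def by (rule energy_bounds)+
qed

lemma e_mono: "k \<le> m \<Longrightarrow> m \<le> n \<Longrightarrow> e n k \<le> e n m"
proof -
  assume a: "k \<le> m" "m \<le> n"
  interpret kernel "V n" "w n" "\<beta> n" by (rule kernel)
  show ?thesis unfolding e_def
    by (rule energy_mono[where f = "\<lambda>a. a div 4 ^ (m - k)"]) (rule coarser'[OF a])
qed

lemma s_bounds: "0 \<le> s n k a" "s n k a \<le> 1"
proof -
  interpret kernel "V n" "w n" "\<beta> n" by (rule kernel)
  show "0 \<le> s n k a" unfolding s_def by (intro sum_nonneg) (auto intro: less_imp_le w_pos)
  show "s n k a \<le> 1" unfolding s_def sum_w[symmetric]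
    by (intro sum_mono2 finite_V) (auto intro: less_imp_le w_pos)
qed

lemma convergent_subsequence:
  obtains r where "strict_mono r" "\<And>k a. convergent (\<lambda>n. s (r n) k a)"
    "\<And>k. convergent (\<lambda>n. e (r n) k)"
    "\<And>k a b. a < 4 ^ k \<Longrightarrow> b < 4 ^ k \<Longrightarrow> convergent (\<lambda>n. d (r n) k a b)"
proof -
  \<comment> \<open>The tag \<open>t\<close> merges three families into one bounded family. The
    value \<open>0\<close> is used where \<open>d_le\<close> gives no bound; since
    \<open>k \<le> r n\<close> eventually, it does not affect the limit.\<close>
  define f :: "nat \<Rightarrow> nat \<times> nat \<times> nat \<times> nat \<Rightarrow> real" where
    "f n = (\<lambda>(t, k, a, b). if t = 0 then s n k a else if t = 1 then e n k / 2
       else if k \<le> n \<and> a < 4 ^ k \<and> b < 4 ^ k then d n k a b / 256 ^ k else 0)" for n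
  have fle: "\<bar>f n x\<bar> \<le> 1" for n x
  proof -
    obtain t k a b where x: "x = (t, k, a, b)" by (cases x) auto
    show ?thesis
      using s_bounds[of n k a] e_bounds[of n k] d_le[of k n a b] by (simp add: f_def x)
  qed
  obtain r where r: "strict_mono r" and conv: "\<And>x. convergent (\<lambda>n. f (r n) x)"
    using bounded_family_convergent_subsequence[of f 1] fle by metis
  show ?thesis
  proof (rule that[OF r])
    show "convergent (\<lambda>n. s (r n) k a)" for k a
      using conv[of "(0, k, a, 0)"] by (simp add: f_def)
    have "convergent (\<lambda>n. 2 * (e (r n) k / 2))" for k
      using conv[of "(1, k, 0, 0)"] by (intro convergent_mult convergent_const) (simp add: f_def)
    then show "convergent (\<lambda>n. e (r n) k)" for k by simp
    fix k a b :: nat assume ab: "a < 4 ^ k" "b < 4 ^ k"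
    have "convergent (\<lambda>n. 256 ^ k * f (r n) (2, k, a, b))"
      by (intro convergent_mult convergent_const conv)
    then obtain l where l: "(\<lambda>n. 256 ^ k * f (r n) (2, k, a, b)) \<longlonglongrightarrow> l" by (auto simp: convergent_def)
    have "eventually (\<lambda>n. 256 ^ k * f (r n) (2, k, a, b) = d (r n) k a b) sequentially"
      using eventually_ge_at_top[of k]
    proof eventually_elim
      case (elim n)
      then have "k \<le> r n" using seq_suble[OF r, of n] by simp
      then show ?case using ab by (simp add: f_def)
    qed
    from tendsto_cong[OF this] l show "convergent (\<lambda>n. d (r n) k a b)" by (auto simp: convergent_def)
  qed
qed

text \<open>Away from the limiting boundaries, \<open>x\<close> ends up strictly on a fixed side of
  each of the finitely many boundaries that decide its label. The exceptional points are countably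
  many.\<close>

lemma label_eventually_const:
  assumes r: "strict_mono r" and lim: "\<And>a. (\<lambda>n. s (r n) k a) \<longlonglongrightarrow> s' a"
    and x: "x \<in> {0..<1}" "x \<notin> range s'"
  obtains c where "c < 4 ^ k"
    "eventually (\<lambda>n. \<forall>i\<in>V (r n). x \<in> J (r n) i \<longrightarrow> \<kappa> (r n) k i = c) sequentially"
proof -
  have ev1: "eventually (\<lambda>n. s (r n) k a \<le> x \<longleftrightarrow> s' a < x) sequentially" for a
  proof (cases "s' a < x")
    case True
    show ?thesis using order_tendstoD(2)[OF lim True] by eventually_elim (use True in auto)
  next
    case False
    then have "x < s' a" using x(2) by (metis antisym_conv3 rangeI)
    show ?thesis using order_tendstoD(1)[OF lim \<open>x < s' a\<close>] by eventually_elim (use False in auto)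
  qed
  have "eventually (\<lambda>n. \<forall>a\<in>{..4 ^ k}. s (r n) k a \<le> x \<longleftrightarrow> s' a < x) sequentially"
    by (rule eventually_ball_finite) (use ev1 in auto)
  then have "eventually (\<lambda>n. k \<le> n \<and> (\<forall>a\<in>{..4 ^ k}. s (r n) k a \<le> x \<longleftrightarrow> s' a < x)) sequentially"
    using eventually_ge_at_top[of k] by eventually_elim auto
  then obtain N where N: "\<And>n. N \<le> n \<Longrightarrow> k \<le> n \<and> (\<forall>a\<in>{..4 ^ k}. s (r n) k a \<le> x \<longleftrightarrow> s' a < x)"
    unfolding eventually_sequentially by blast
  have key: "a \<le> \<kappa> (r n) k i \<longleftrightarrow> s' a < x" and lt: "\<kappa> (r n) k i < 4 ^ k"
    if "N \<le> n" "i \<in> V (r n)" "x \<in> J (r n) i" "a \<le> 4 ^ k" for n i a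
  proof -
    have kn: "k \<le> r n" using N[OF that(1)] seq_suble[OF r, of n] by simp
    show "a \<le> \<kappa> (r n) k i \<longleftrightarrow> s' a < x"
      using label_le_iff[OF kn that(2,3), of a] N[OF that(1)] that(4) by auto
    show "\<kappa> (r n) k i < 4 ^ k" by (rule label_less[OF kn that(2)])
  qed
  obtain i0 where i0: "i0 \<in> V (r N)" "x \<in> J (r N) i0"
    using tiling_cell[OF tile, of x "r N"] x(1) by auto
  define c where "c = \<kappa> (r N) k i0"
  have c: "c < 4 ^ k" unfolding c_def by (rule lt[OF order_refl i0, of 0]) simp
  have "\<kappa> (r n) k i = c" if "N \<le> n" "i \<in> V (r n)" "x \<in> J (r n) i" for n i
  proof -
    have k4: "\<kappa> (r n) k i < 4 ^ k" by (rule lt[OF that, of 0]) simp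
    have "a \<le> \<kappa> (r n) k i \<longleftrightarrow> a \<le> c" if "a \<le> 4 ^ k" for a
      using key[OF \<open>N \<le> n\<close> \<open>i \<in> V (r n)\<close> \<open>x \<in> J (r n) i\<close> that] key[OF order_refl i0 that] by (simp add: c_def)
    from this[of c] this[of "\<kappa> (r n) k i"] c k4 show ?thesis by simp
  qed
  then have "eventually (\<lambda>n. \<forall>i\<in>V (r n). x \<in> J (r n) i \<longrightarrow> \<kappa> (r n) k i = c) sequentially"
    unfolding eventually_sequentially by blast
  then show ?thesis using that c by blast
qed

text \<open>Almost everywhere both labels settle at some \<open>a\<close> and \<open>b\<close>, so
  \<open>U (r n) k z\<close> eventually equals the convergent \<open>d (r n) k a b\<close>. The
  bound of \<open>U_le\<close> then allows dominated convergence.\<close>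

lemma level_limit:
  assumes r: "strict_mono r" and s: "\<And>a. convergent (\<lambda>n. s (r n) k a)"
    and d: "\<And>a b. a < 4 ^ k \<Longrightarrow> b < 4 ^ k \<Longrightarrow> convergent (\<lambda>n. d (r n) k a b)"
  defines "L \<equiv> \<lambda>z. lim (\<lambda>n. U (r n) k z)"
  shows "integrable lborel L" "(\<lambda>n. LINT z|lborel. \<bar>U (r n) k z - L z\<bar>) \<longlonglongrightarrow> 0"
proof -
  define s' where "s' a = lim (\<lambda>n. s (r n) k a)" for a
  have s': "(\<lambda>n. s (r n) k a) \<longlonglongrightarrow> s' a" for a
    using s[of a] by (simp add: s'_def convergent_LIMSEQ_iff)
  have "AE z in lborel. fst z \<notin> range s' \<and> snd z \<notin> range s'"
    by (rule AE_lborel_pair_notin) simp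
  then have conv: "AE z in lborel. (\<lambda>n. U (r n) k z) \<longlonglongrightarrow> L z"
  proof eventually_elim
    case (elim z)
    obtain x y where z: "z = (x, y)" by (cases z)
    have "convergent (\<lambda>n. U (r n) k z)"
    proof (cases "x \<in> {0..<1} \<and> y \<in> {0..<1}")
      case False
      then have "(\<lambda>n. U (r n) k z) = (\<lambda>n. 0)" using U_outside[of x y] by (auto simp: z)
      then show ?thesis by (simp add: convergent_const)
    next
      case True
      obtain a where a: "a < 4 ^ k"
        "eventually (\<lambda>n. \<forall>i\<in>V (r n). x \<in> J (r n) i \<longrightarrow> \<kappa> (r n) k i = a) sequentially"
        using label_eventually_const[OF r s', of x] True elim z by auto
      obtain b where b: "b < 4 ^ k"
        "eventually (\<lambda>n. \<forall>i\<in>V (r n). y \<in> J (r n) i \<longrightarrow> \<kappa> (r n) k i = b) sequentially"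
        using label_eventually_const[OF r s', of y] True elim z by auto
      have "eventually (\<lambda>n. d (r n) k a b = U (r n) k z) sequentially"
        using a(2) b(2)
      proof eventually_elim
        case (elim n)
        obtain i j where "i \<in> V (r n)" "x \<in> J (r n) i" "j \<in> V (r n)" "y \<in> J (r n) j"
          using tiling_cell[OF tile, of x "r n"] tiling_cell[OF tile, of y "r n"] True
          by (metis atLeastLessThan_iff)
        then show ?case using elim by (simp add: z U_cell)
      qed
      from tendsto_cong[OF this] d[OF a(1) b(1)] show ?thesis by (auto simp: convergent_def)
    qed
    then show ?case by (simp add: L_def convergent_LIMSEQ_iff)
  qed
  have [measurable]: "L \<in> borel_measurable borel" unfolding L_def by measurable
  have b_int: "integrable lborel (\<lambda>z. 256 ^ k * indicator unit_square z :: real)"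
    by (intro integrable_mult_right integrable_real_indicator)
      (auto simp: emeasure_lborel_Times measurable_Times_borel)
  \<comment> \<open>Graph \<open>n\<close> is refined only up to level \<open>n\<close>, so the
    first \<open>k\<close> terms are skipped.\<close>
  have kn: "k \<le> r (n + k)" for n using seq_suble[OF r, of "n + k"] by simp
  have conv': "AE z in lborel. (\<lambda>n. U (r (n + k)) k z) \<longlonglongrightarrow> L z"
    using conv by eventually_elim (rule LIMSEQ_ignore_initial_segment)
  show int: "integrable lborel L"
    by (rule integrable_dominated_convergence[OF _ _ b_int conv']) (use U_le[OF kn] in auto)
  have "(\<lambda>n. LINT z|lborel. \<bar>U (r (n + k)) k z - L z\<bar>) \<longlonglongrightarrow> (LINT z|(lborel :: (real \<times> real) measure). 0)"
  proof (rule integral_dominated_convergence)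
    show "integrable lborel (\<lambda>z. 256 ^ k * indicator unit_square z + \<bar>L z\<bar>)"
      using b_int int by simp
    show "AE z in lborel. (\<lambda>n. \<bar>U (r (n + k)) k z - L z\<bar>) \<longlonglongrightarrow> 0"
      using conv' by eventually_elim (simp add: tendsto_rabs_zero_iff LIM_zero_iff)
    show "AE z in lborel. norm \<bar>U (r (n + k)) k z - L z\<bar> \<le> 256 ^ k * indicator unit_square z + \<bar>L z\<bar>" for n
    proof (intro AE_I2)
      fix z show "norm \<bar>U (r (n + k)) k z - L z\<bar> \<le> 256 ^ k * indicator unit_square z + \<bar>L z\<bar>"
        using U_le[OF kn[of n], of z] by (simp only: real_norm_def abs_idempotent)
    qed
  qed auto
  then have "(\<lambda>n. LINT z|lborel. \<bar>U (r (n + k)) k z - L z\<bar>) \<longlonglongrightarrow> 0" by simp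
  then show "(\<lambda>n. LINT z|lborel. \<bar>U (r n) k z - L z\<bar>) \<longlonglongrightarrow> 0" by (rule LIMSEQ_offset)
qed

text \<open>The level \<open>k j\<close> is chosen by the Cauchy property of the level limits, and
  only then a graph close to its limits at levels \<open>k j\<close> and \<open>Suc (k j)\<close>.
  The closeness at both levels makes the last conclusion hold, which is what the discrepancy bound
  requires.\<close>

lemma diagonal_limit:
  obtains \<phi> k :: "nat \<Rightarrow> nat" and W where "\<And>j. j \<le> \<phi> j" "\<And>j. k j < \<phi> j" "integrable lborel W"
    "\<And>x y. W (x, y) = W (y, x)"
    "AE z in lborel. (\<lambda>j. U (\<phi> j) (k j) z) \<longlonglongrightarrow> W z"
    "(\<lambda>j. LINT z|lborel. \<bar>U (\<phi> j) (k j) z - W z\<bar>) \<longlonglongrightarrow> 0"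
    "(\<lambda>j. LINT z|lborel. \<bar>U (\<phi> j) (Suc (k j)) z - U (\<phi> j) (k j) z\<bar>) \<longlonglongrightarrow> 0"
proof -
  obtain r where r: "strict_mono r" and s: "\<And>k a. convergent (\<lambda>n. s (r n) k a)"
    and e: "\<And>k. convergent (\<lambda>n. e (r n) k)"
    and d: "\<And>k a b. a < 4 ^ k \<Longrightarrow> b < 4 ^ k \<Longrightarrow> convergent (\<lambda>n. d (r n) k a b)"
    by (rule convergent_subsequence) blast
  have rn: "n \<le> r n" for n by (rule seq_suble[OF r])
  define L where "L k z = lim (\<lambda>n. U (r n) k z)" for k z
  have L_int: "integrable lborel (L k)" for k
    using level_limit(1)[OF r s d] unfolding L_def[abs_def] .
  define D where "D f h = (LINT z|lborel. \<bar>f z - h z\<bar>)" for f h :: "real \<times> real \<Rightarrow> real"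
  have D_lim: "(\<lambda>n. D (U (r n) k) (L k)) \<longlonglongrightarrow> 0" for k
    using level_limit(2)[OF r s d] unfolding L_def[abs_def] D_def .
  have D_sym: "D f h = D h f" for f h unfolding D_def by (simp add: abs_minus_commute)
  have D_tri: "D f1 f3 \<le> D f1 f2 + D f2 f3"
    if "integrable lborel f1" "integrable lborel f2" "integrable lborel f3" for f1 f2 f3
  proof -
    have "D f1 f3 \<le> (LINT z|lborel. \<bar>f1 z - f2 z\<bar> + \<bar>f2 z - f3 z\<bar>)"
      unfolding D_def using that by (intro integral_mono) auto
    also have "\<dots> = D f1 f2 + D f2 f3" unfolding D_def using that by (intro Bochner_Integration.integral_add) auto
    finally show ?thesis .
  qed
  define E where "E k = lim (\<lambda>n. e (r n) k)" for k
  have E: "(\<lambda>n. e (r n) k) \<longlonglongrightarrow> E k" for k using e[of k] by (simp add: E_def convergent_LIMSEQ_iff)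
  have "E k \<le> E m" if "k \<le> m" for k m
  proof (rule LIMSEQ_le[OF E E], intro exI allI impI)
    fix n assume "m \<le> n"
    then show "e (r n) k \<le> e (r n) m" using that rn[of n] by (intro e_mono) auto
  qed
  then have "incseq E" by (simp add: incseq_def)
  moreover have "E k \<le> 2" for k by (rule LIMSEQ_le_const2[OF E]) (use e_bounds in auto)
  ultimately obtain E\<^sub>0 where E\<^sub>0: "E \<longlonglongrightarrow> E\<^sub>0" "\<And>k. E k \<le> E\<^sub>0"
    using incseq_convergent by metis
  have L_dist: "D (L m) (L k) \<le> \<epsilon> + M ^ 3 / (2 * \<epsilon>) * (E m - E k)
      + 2 * 2 powr q * M powr (1 - q) * (2 + B + B)"
    if "k \<le> m" "0 < \<epsilon>" "1 \<le> M" for k m \<epsilon> M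
  proof (rule LIMSEQ_le_const[where a = "D (L m) (L k)"])
    let ?f = "\<lambda>n. D (U (r n) m) (L m) + (\<epsilon> + M ^ 3 / (2 * \<epsilon>) * (e (r n) m - e (r n) k)
      + 2 * 2 powr q * M powr (1 - q) * (2 + B + B)) + D (U (r n) k) (L k)"
    have "?f \<longlonglongrightarrow> 0 + (\<epsilon> + M ^ 3 / (2 * \<epsilon>) * (E m - E k)
      + 2 * 2 powr q * M powr (1 - q) * (2 + B + B)) + 0"
      by (intro tendsto_intros D_lim E)
    then show "?f \<longlonglongrightarrow> \<epsilon> + M ^ 3 / (2 * \<epsilon>) * (E m - E k)
      + 2 * 2 powr q * M powr (1 - q) * (2 + B + B)" by simp
    show "\<exists>N. \<forall>n\<ge>N. D (L m) (L k) \<le> ?f n"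
    proof (intro exI allI impI)
      fix n assume "m \<le> n"
      then have "D (U (r n) m) (U (r n) k) \<le> \<epsilon> + M ^ 3 / (2 * \<epsilon>) * (e (r n) m - e (r n) k)
        + 2 * 2 powr q * M powr (1 - q) * (2 + B + B)"
        unfolding D_def using that rn[of n] by (intro U_dist_energy) auto
      moreover have "D (L m) (L k) \<le> D (L m) (U (r n) m) + (D (U (r n) m) (U (r n) k) + D (U (r n) k) (L k))"
        using D_tri[OF L_int[of m] U_integrable[of "r n" m] L_int[of k]]
          D_tri[OF U_integrable[of "r n" m] U_integrable[of "r n" k] L_int[of k]] by linarith
      ultimately show "D (L m) (L k) \<le> ?f n" using D_sym[of "L m" "U (r n) m"] by linarith
    qed
  qed
  \<comment> \<open>\<open>\<delta>\<close> is divided among three terms: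
    \<open>\<epsilon> = \<delta> / 3\<close>, then \<open>M\<close> for the tail, then
    \<open>k\<close> so late that the remaining energy is below
    \<open>\<delta> / 3 / c\<close>.\<close>
  have Cauchy: "\<exists>k. \<forall>m\<ge>k. D (L m) (L k) \<le> \<delta>" if \<delta>: "0 < \<delta>" for \<delta>
  proof -
    have "((\<lambda>M. 2 * 2 powr q * M powr (1 - q) * (2 + B + B)) \<longlongrightarrow> 2 * 2 powr q * 0 * (2 + B + B)) at_top"
      using q by (intro tendsto_intros tendsto_neg_powr filterlim_ident) auto
    then have "eventually (\<lambda>M. 2 * 2 powr q * M powr (1 - q) * (2 + B + B) < \<delta> / 3) at_top"
      using \<delta> by (intro order_tendstoD(2)[where y = 0 and a = "\<delta> / 3"]) auto
    then have "eventually (\<lambda>M. 1 \<le> M \<and> 2 * 2 powr q * M powr (1 - q) * (2 + B + B) < \<delta> / 3) at_top"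
      using eventually_ge_at_top[of "1 :: real"] by eventually_elim auto
    then obtain M :: real where M: "1 \<le> M" "2 * 2 powr q * M powr (1 - q) * (2 + B + B) < \<delta> / 3"
      by (auto simp: eventually_at_top_linorder)
    define c where "c = M ^ 3 / (2 * (\<delta> / 3))"
    have c: "0 < c" using M \<delta> by (simp add: c_def)
    have "eventually (\<lambda>k. E\<^sub>0 - \<delta> / 3 / c < E k) sequentially"
      by (rule order_tendstoD(1)[OF E\<^sub>0(1)]) (use \<delta> c in auto)
    then obtain k where k: "E\<^sub>0 - \<delta> / 3 / c < E k" by (auto simp: eventually_sequentially)
    have "D (L m) (L k) \<le> \<delta>" if "k \<le> m" for m
    proof -
      have "E m - E k \<le> \<delta> / 3 / c" using E\<^sub>0(2)[of m] k by linarith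
      then have "c * (E m - E k) \<le> \<delta> / 3" using c by (simp add: field_simps)
      moreover have "D (L m) (L k) \<le> \<delta> / 3 + c * (E m - E k) + 2 * 2 powr q * M powr (1 - q) * (2 + B + B)"
        unfolding c_def using \<delta> M that by (intro L_dist) auto
      ultimately show ?thesis using M by linarith
    qed
    then show ?thesis by blast
  qed
  define \<delta> where "\<delta> j = (1 / 2 :: real) ^ j / 16" for j :: nat
  have \<delta>: "0 < \<delta> j" "\<delta> (Suc j) \<le> \<delta> j" for j by (simp_all add: \<delta>_def)
  have "\<forall>j. \<exists>k. \<forall>m\<ge>k. D (L m) (L k) \<le> \<delta> j" using Cauchy \<delta> by blast
  from choice[OF this] obtain k where k: "\<And>j m. k j \<le> m \<Longrightarrow> D (L m) (L (k j)) \<le> \<delta> j" by blast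
  have "\<forall>j. \<exists>n. j \<le> n \<and> k j < n \<and> D (U (r n) (k j)) (L (k j)) \<le> \<delta> j \<and>
     D (U (r n) (Suc (k j))) (L (Suc (k j))) \<le> \<delta> j"
  proof
    fix j
    have "eventually (\<lambda>n. D (U (r n) (k j)) (L (k j)) < \<delta> j) sequentially"
      "eventually (\<lambda>n. D (U (r n) (Suc (k j))) (L (Suc (k j))) < \<delta> j) sequentially"
      by (rule order_tendstoD(2)[OF D_lim \<delta>(1)])+
    then have "eventually (\<lambda>n. j \<le> n \<and> k j < n \<and> D (U (r n) (k j)) (L (k j)) \<le> \<delta> j \<and>
       D (U (r n) (Suc (k j))) (L (Suc (k j))) \<le> \<delta> j) sequentially"
      using eventually_ge_at_top[of j] eventually_gt_at_top[of "k j"] by eventually_elim auto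
    then show "\<exists>n. j \<le> n \<and> k j < n \<and> D (U (r n) (k j)) (L (k j)) \<le> \<delta> j \<and>
       D (U (r n) (Suc (k j))) (L (Suc (k j))) \<le> \<delta> j" by (auto simp: eventually_sequentially)
  qed
  from choice[OF this] obtain n where n: "\<And>j. j \<le> n j" "\<And>j. k j < n j"
    "\<And>j. D (U (r (n j)) (k j)) (L (k j)) \<le> \<delta> j"
    "\<And>j. D (U (r (n j)) (Suc (k j))) (L (Suc (k j))) \<le> \<delta> j" by blast
  define \<phi> where "\<phi> j = r (n j)" for j
  define F where "F j = U (\<phi> j) (k j)" for j
  have F_int: "integrable lborel (F j)" for j by (simp add: F_def U_integrable)
  have FL: "D (F j) (L (k j)) \<le> \<delta> j" for j using n(3) by (simp add: F_def \<phi>_def)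
  have fast: "(LINT z|lborel. \<bar>F (Suc j) z - F j z\<bar>) \<le> (1 / 2) ^ j" for j
  proof -
    \<comment> \<open>The chosen levels need not increase with \<open>j\<close>, so the two are
      compared through a level above both. This makes four errors in all, each at most
      \<open>\<delta> j\<close>.\<close>
    define m where "m = max (k j) (k (Suc j))"
    have "D (F (Suc j)) (F j) \<le> D (F (Suc j)) (L (k (Suc j))) + D (L (k (Suc j))) (F j)"
      by (intro D_tri F_int L_int)
    moreover have "D (L (k (Suc j))) (F j) \<le> D (L (k (Suc j))) (L (k j)) + D (L (k j)) (F j)"
      by (intro D_tri F_int L_int)
    moreover have "D (L (k (Suc j))) (L (k j)) \<le> D (L (k (Suc j))) (L m) + D (L m) (L (k j))"
      by (intro D_tri L_int)
    moreover have "D (L m) (L (k (Suc j))) \<le> \<delta> (Suc j)" "D (L m) (L (k j)) \<le> \<delta> j"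
      by (intro k; simp add: m_def)+
    ultimately have "D (F (Suc j)) (F j) \<le> 4 * \<delta> j"
      using FL[of j] FL[of "Suc j"] \<delta>(2)[of j] D_sym[of "L (k j)" "F j"] D_sym[of "L m" "L (k (Suc j))"]
      by linarith
    also have "\<dots> \<le> (1 / 2) ^ j" by (simp add: \<delta>_def)
    finally show ?thesis by (simp add: D_def)
  qed
  note lim = L1_fast_Cauchy_limit[OF F_int fast]
  have step: "D (U (\<phi> j) (Suc (k j))) (F j) \<le> 3 * \<delta> j" for j
  proof -
    have "D (U (\<phi> j) (Suc (k j))) (F j) \<le> D (U (\<phi> j) (Suc (k j))) (L (Suc (k j))) + D (L (Suc (k j))) (F j)"
      by (intro D_tri F_int L_int U_integrable)
    moreover have "D (L (Suc (k j))) (F j) \<le> D (L (Suc (k j))) (L (k j)) + D (L (k j)) (F j)"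
      by (intro D_tri F_int L_int)
    moreover have "D (L (Suc (k j))) (L (k j)) \<le> \<delta> j" by (intro k) simp
    ultimately show ?thesis using n(4)[of j] FL[of j] D_sym[of "L (k j)" "F j"] by (simp add: \<phi>_def)
  qed
  have "(\<lambda>j. 3 * \<delta> j) \<longlonglongrightarrow> 3 * (0 / 16)" unfolding \<delta>_def
    by (intro tendsto_intros LIMSEQ_power_zero) auto
  then have \<delta>0: "(\<lambda>j. 3 * \<delta> j) \<longlonglongrightarrow> 0" by simp
  have "(\<lambda>j. D (U (\<phi> j) (Suc (k j))) (F j)) \<longlonglongrightarrow> 0"
  proof (rule tendsto_sandwich[OF _ _ tendsto_const \<delta>0])
    show "eventually (\<lambda>j. 0 \<le> D (U (\<phi> j) (Suc (k j))) (F j)) sequentially"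
      by (intro always_eventually allI) (simp add: D_def)
    show "eventually (\<lambda>j. D (U (\<phi> j) (Suc (k j))) (F j) \<le> 3 * \<delta> j) sequentially"
      by (intro always_eventually allI step)
  qed
  then have s3: "(\<lambda>j. LINT z|lborel. \<bar>U (\<phi> j) (Suc (k j)) z - U (\<phi> j) (k j) z\<bar>) \<longlonglongrightarrow> 0"
    by (simp add: D_def F_def)
  \<comment> \<open>Holds at points of divergence too: both sides are the limit of the same sequence.\<close>
  have s4: "lim (\<lambda>j. F j (x, y)) = lim (\<lambda>j. F j (y, x))" for x y
    unfolding F_def by (subst U_sym) (rule refl)
  show ?thesis
  proof (rule that[of \<phi> k "\<lambda>z. lim (\<lambda>j. F j z)"])
    show "j \<le> \<phi> j" "k j < \<phi> j" for j
      using rn[of "n j"] n(1,2)[of j] by (auto simp: \<phi>_def)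
  qed (use lim s3 s4 in \<open>simp_all add: F_def\<close>)
qed

end

section \<open>Upper regular weighted graphs\<close>

lemma total_weight_pos: "weighted_graph G \<Longrightarrow> 0 < total_weight G"
  unfolding weighted_graph_def total_weight_def set_weight_def by (intro sum_pos) auto

lemma norm1_pos:
  assumes "weighted_graph G" "norm1 G \<noteq> 0"
  shows "0 < norm1 G"
proof -
  have "0 \<le> norm1 G"
    unfolding norm1_def using assms(1)
    by (intro sum_nonneg mult_nonneg_nonneg divide_nonneg_nonneg)
      (auto simp: weighted_graph_def intro: less_imp_le)
  then show ?thesis using assms(2) by simp
qed

abbreviation nweight :: "'v wgraph \<Rightarrow> 'v \<Rightarrow> real" where
  "nweight G i \<equiv> vweight G i / total_weight G"

abbreviation nedge :: "'v wgraph \<Rightarrow> 'v \<Rightarrow> 'v \<Rightarrow> real" where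
  "nedge G i j \<equiv> eweight G i j / norm1 G"

lemma graph_kernel:
  assumes G: "weighted_graph G" "norm1 G \<noteq> 0"
  shows "kernel (verts G) (nweight G) (nedge G)"
proof
  show "finite (verts G)" using G by (simp add: weighted_graph_def)
  show "0 < nweight G i" if "i \<in> verts G" for i
    using that G total_weight_pos[OF G(1)] by (simp add: weighted_graph_def)
  show "sum (nweight G) (verts G) = 1"
    using total_weight_pos[OF G(1)]
    by (simp add: sum_divide_distrib[symmetric]) (simp add: total_weight_def set_weight_def)
  show "nedge G i j = nedge G j i" if "i \<in> verts G" "j \<in> verts G" for i j
    using that G by (simp add: weighted_graph_def)
  have "(\<Sum>i\<in>verts G. \<Sum>j\<in>verts G. nweight G i * nweight G j * \<bar>nedge G i j\<bar>) = norm1 G / norm1 G"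
    unfolding norm1_def[of G] sum_divide_distrib
    unfolding norm1_def[of G, symmetric] using norm1_pos[OF G]
    by (intro sum.cong refl) (simp add: abs_divide power2_eq_square)
  then show "(\<Sum>i\<in>verts G. \<Sum>j\<in>verts G. nweight G i * nweight G j * \<bar>nedge G i j\<bar>) \<le> 1"
    using G(2) by simp
qed

lemma set_weight_eq:
  "weighted_graph G \<Longrightarrow> set_weight G A = total_weight G * sum (nweight G) A"
  using total_weight_pos[of G] by (simp add: set_weight_def sum_divide_distrib[symmetric])

text \<open>The blocks form a partition admissible in the regularity hypothesis, and their
  normalised edge densities are the averages. The hypothesis \<open>large\<close> is what makes the
  partition admissible.\<close>

lemma regular_avg_bound:
  fixes G :: "'v wgraph" and p :: ereal
  assumes G: "weighted_graph G" "norm1 G \<noteq> 0" and reg: "upper_Lp_regular c \<eta> p G"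
    and large: "\<And>i. i \<in> verts G \<Longrightarrow> \<eta> \<le> sum (nweight G) (kernel.block (verts G) \<kappa> (\<kappa> i))"
  defines "A \<equiv> \<lambda>i j. kernel.avg (verts G) (nweight G) (nedge G) \<kappa> (\<kappa> i) (\<kappa> j)"
  shows "p \<noteq> \<infinity> \<Longrightarrow> kernel.mean (verts G) (nweight G) (\<lambda>i j. \<bar>A i j\<bar> powr real_of_ereal p) \<le> c powr real_of_ereal p"
    and "p = \<infinity> \<Longrightarrow> i \<in> verts G \<Longrightarrow> j \<in> verts G \<Longrightarrow> \<bar>A i j\<bar> \<le> c"
proof -
  interpret kernel "verts G" "nweight G" "nedge G" by (rule graph_kernel[OF G])
  define t where "t = total_weight G"
  have t: "0 < t" unfolding t_def by (rule total_weight_pos[OF G(1)])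
  have sw: "set_weight G X = t * sum (nweight G) X" for X
    unfolding t_def by (rule set_weight_eq[OF G(1)])
  \<comment> \<open>Restricting to labels that occur keeps out the empty block and makes
    \<open>block\<close> injective, so sums over blocks are sums over labels.\<close>
  define P where "P = block \<kappa> ` (\<kappa> ` verts G)"
  have inj: "inj_on (block \<kappa>) (\<kappa> ` verts G)"
    by (rule inj_onI) (auto simp: block_def)
  have part: "partition_on (verts G) P"
    by (rule partition_onI) (auto simp: P_def block_def disjnt_def)
  have "\<forall>X\<in>P. set_weight G X \<ge> \<eta> * total_weight G"
    using large t unfolding P_def sw t_def[symmetric] by (auto simp: mult.commute)
  with part reg have main: "if p = \<infinity>
         then Max ((\<lambda>(U, V). \<bar>edge_density G U V\<bar> / norm1 G) ` (P \<times> P)) \<le> c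
         else (\<Sum>U\<in>P. \<Sum>V\<in>P. set_weight G U * set_weight G V / (total_weight G)\<^sup>2 *
                 \<bar>edge_density G U V / norm1 G\<bar> powr real_of_ereal p)
              \<le> c powr real_of_ereal p"
    unfolding upper_Lp_regular_def by blast
  have dens: "edge_density G (block \<kappa> a) (block \<kappa> b) / norm1 G = avg \<kappa> a b" for a b
    unfolding edge_density_def avg_def mass_def sw sum_divide_distrib
    using t by (intro sum.cong refl) (simp add: t_def[symmetric] power2_eq_square field_simps)
  show "p \<noteq> \<infinity> \<Longrightarrow> mean (\<lambda>i j. \<bar>A i j\<bar> powr real_of_ereal p) \<le> c powr real_of_ereal p"
  proof -
    assume "p \<noteq> \<infinity>"
    have "mean (\<lambda>i j. \<bar>A i j\<bar> powr real_of_ereal p) = (\<Sum>a\<in>\<kappa> ` verts G. \<Sum>b\<in>\<kappa> ` verts G.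
        sum (nweight G) (block \<kappa> a) * sum (nweight G) (block \<kappa> b) * \<bar>avg \<kappa> a b\<bar> powr real_of_ereal p)"
      unfolding A_def by (rule mean_label[where H = "\<lambda>a b. \<bar>avg \<kappa> a b\<bar> powr real_of_ereal p"])
    also have "\<dots> = (\<Sum>U\<in>P. \<Sum>V\<in>P. set_weight G U * set_weight G V / (total_weight G)\<^sup>2 *
                 \<bar>edge_density G U V / norm1 G\<bar> powr real_of_ereal p)"
      unfolding P_def sum.reindex[OF inj] comp_def dens sw t_def[symmetric]
      using t by (intro sum.cong refl) (simp add: power2_eq_square)
    also have "\<dots> \<le> c powr real_of_ereal p" using main \<open>p \<noteq> \<infinity>\<close> by simp
    finally show ?thesis .
  qed
  show "\<bar>A i j\<bar> \<le> c" if "p = \<infinity>" "i \<in> verts G" "j \<in> verts G"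
  proof -
    let ?X = "(\<lambda>(U, V). \<bar>edge_density G U V\<bar> / norm1 G) ` (P \<times> P)"
    have "finite P" unfolding P_def using finite_V by simp
    have "\<bar>A i j\<bar> = \<bar>edge_density G (block \<kappa> (\<kappa> i)) (block \<kappa> (\<kappa> j))\<bar> / norm1 G"
      unfolding A_def dens[symmetric] using norm1_pos[OF G] by (simp add: abs_divide)
    also have "\<dots> \<le> Max ?X"
    proof (rule Max_ge)
      show "\<bar>edge_density G (block \<kappa> (\<kappa> i)) (block \<kappa> (\<kappa> j))\<bar> / norm1 G \<in> ?X"
        by (rule image_eqI[where x = "(block \<kappa> (\<kappa> i), block \<kappa> (\<kappa> j))"]) (use that in \<open>auto simp: P_def\<close>)
    qed (use \<open>finite P\<close> in simp)
    also have "\<dots> \<le> c" using main that(1) by simp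
    finally show ?thesis .
  qed
qed

lemma graphon_of_scale_graph:
  fixes G :: "'v::linorder wgraph"
  assumes G: "weighted_graph G"
  shows "graphon_of (scale_graph (1 / norm1 G) G) =
    step (verts G) (cell (nweight G) (\<lambda>i. \<Sum>j\<in>{j \<in> verts G. j < i}. nweight G j)) (nedge G)"
proof -
  have "vertex_interval G i = cell (nweight G) (\<lambda>i. \<Sum>j\<in>{j \<in> verts G. j < i}. nweight G j) i"
    if i: "i \<in> verts G" for i
  proof -
    have "{j \<in> verts G. j \<le> i} = insert i {j \<in> verts G. j < i}" using i by auto
    moreover have "finite {j \<in> verts G. j < i}" using G by (simp add: weighted_graph_def)
    ultimately have "set_weight G {j \<in> verts G. j \<le> i} = set_weight G {j \<in> verts G. j < i} + vweight G i"
      by (simp add: set_weight_def)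
    then show ?thesis
      unfolding vertex_interval_def cell_def by (simp add: set_weight_def sum_divide_distrib add_divide_distrib)
  qed
  then have "(\<Sum>i\<in>verts G. \<Sum>j\<in>verts G. eweight (scale_graph (1 / norm1 G) G) i j *
       indicator (vertex_interval G i) x * indicator (vertex_interval G j) y) =
     (\<Sum>i\<in>verts G. \<Sum>j\<in>verts G. nedge G i j *
       indicator (cell (nweight G) (\<lambda>i. \<Sum>j\<in>{j \<in> verts G. j < i}. nweight G j) i) x *
       indicator (cell (nweight G) (\<lambda>i. \<Sum>j\<in>{j \<in> verts G. j < i}. nweight G j) j) y)" for x y
    by (intro sum.cong refl) (simp add: scale_graph_def)
  moreover have "vertex_interval (scale_graph (1 / norm1 G) G) = vertex_interval G"
    "verts (scale_graph (1 / norm1 G) G) = verts G"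
    by (simp_all add: scale_graph_def fun_eq_iff vertex_interval_def set_weight_def total_weight_def)
  ultimately show ?thesis by (simp add: graphon_of_def step_def)
qed

text \<open>The graphon lays the vertices out in their given order, while the analysis needs an
  order adapted to the blocks. The infimum in the cut distance absorbs the difference, so the layout
  \<open>l\<close> is free.\<close>

lemma graph_cut_dist_le:
  fixes G :: "'v::linorder wgraph"
  assumes G: "weighted_graph G" "norm1 G \<noteq> 0"
    and t: "tiling (verts G) (nweight G) l"
    and D: "\<And>S T. S \<subseteq> verts G \<Longrightarrow> T \<subseteq> verts G \<Longrightarrow>
      \<bar>\<Sum>i\<in>S. \<Sum>j\<in>T. nweight G i * nweight G j * (nedge G i j - F i j)\<bar> \<le> D"
    and W: "integrable lborel W"
  shows "graph_cut_dist (scale_graph (1 / norm1 G) G) W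
    \<le> ereal (D + (LINT z|lborel. \<bar>step (verts G) (cell (nweight G) l) F z - W z\<bar>))"
proof -
  interpret kernel "verts G" "nweight G" "nedge G" by (rule graph_kernel[OF G])
  define l' where "l' i = (\<Sum>j\<in>{j \<in> verts G. j < i}. nweight G j)" for i
  have t': "tiling (verts G) (nweight G) l'"
    unfolding l'_def[abs_def] using tiling_of_key[OF finite_V w_pos sum_w inj_on_id] by simp
  obtain \<sigma> where \<sigma>: "measure_preserving_bij \<sigma>"
    "\<And>x i. x \<in> {0..1} \<Longrightarrow> i \<in> verts G \<Longrightarrow> \<sigma> x \<in> cell (nweight G) l' i \<longleftrightarrow> x \<in> cell (nweight G) l i"
    using tiling_exchange[OF t t'] by blast
  have "rearrange \<sigma> (graphon_of (scale_graph (1 / norm1 G) G)) z = step (verts G) (cell (nweight G) l) (nedge G) z"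
    if zS: "z \<in> unit_square" for z
  proof -
    obtain x y where z: "z = (x, y)" "x \<in> {0..1}" "y \<in> {0..1}" using zS by (cases z) auto
    show ?thesis
      unfolding graphon_of_scale_graph[OF G(1)] l'_def[symmetric, abs_def] rearrange_def step_def z
      using \<sigma>(2)[OF z(2)] \<sigma>(2)[OF z(3)] by (auto intro!: sum.cong simp: indicator_def)
  qed
  then have "cut_norm (\<lambda>z. rearrange \<sigma> (graphon_of (scale_graph (1 / norm1 G) G)) z - W z)
    \<le> ereal (D + (LINT z|lborel. \<bar>step (verts G) (cell (nweight G) l) F z - W z\<bar>))"
    by (intro cut_norm_le[OF t D W])
  then show ?thesis
    unfolding graph_cut_dist_def cut_dist_def using \<sigma>(1) by (intro INF_lower2) auto
qed

lemma cut_norm_nonneg: "0 \<le> cut_norm W"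
  unfolding cut_norm_def by (rule SUP_upper2[where i = "({}, {})"]) auto

lemma graph_cut_dist_nonneg: "0 \<le> graph_cut_dist G W"
  unfolding graph_cut_dist_def cut_dist_def by (intro INF_greatest cut_norm_nonneg)

text \<open>The indices need not increase: \<open>n \<le> \<rho> n\<close> already reaches every
  tail of the sequence, which is enough for a liminf.\<close>

lemma ex_regular_subsequence:
  assumes reg: "upper_Lp_regular_seq C p G" and \<eta>: "\<And>n. 0 < \<eta> n"
  obtains \<rho> :: "nat \<Rightarrow> nat" where "\<And>n. n \<le> \<rho> n" "\<And>n. upper_Lp_regular (C + \<eta> n) (\<eta> n) p (G (\<rho> n))"
proof -
  have "\<forall>n. \<exists>m\<ge>n. upper_Lp_regular (C + \<eta> n) (\<eta> n) p (G m)"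
    using reg \<eta> unfolding upper_Lp_regular_seq_def by (meson nle_le)
  from choice[OF this] show ?thesis using that by blast
qed

text \<open>Fatou's lemma for finite \<open>p\<close>, a pointwise limit for infinite
  \<open>p\<close>. Bounds varying with \<open>n\<close> are allowed so that the limit receives the
  sharp constant.\<close>

lemma Lp_norm_AE_limit_le:
  fixes f :: "nat \<Rightarrow> real \<times> real \<Rightarrow> real"
  assumes p: "1 < p" and C: "0 < C" and f [measurable]: "\<And>n. f n \<in> borel_measurable borel"
    and W [measurable]: "W \<in> borel_measurable borel"
    and conv: "AE z in lborel. (\<lambda>n. f n z) \<longlonglongrightarrow> W z" and c: "c \<longlonglongrightarrow> C" "\<And>n. 0 \<le> c n"
    and fin: "\<And>n. p \<noteq> \<infinity> \<Longrightarrow>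
      (\<integral>\<^sup>+z. ennreal (\<bar>f n z\<bar> powr real_of_ereal p) \<partial>lborel) \<le> ennreal (c n powr real_of_ereal p)"
    and inf: "\<And>n z. p = \<infinity> \<Longrightarrow> \<bar>f n z\<bar> \<le> c n"
  shows "Lp_norm p W \<le> ereal C"
proof (cases "p = \<infinity>")
  case True
  have "AE z in lborel. \<bar>W z\<bar> \<le> C"
    using conv
  proof eventually_elim
    case (elim z)
    show ?case by (rule LIMSEQ_le[OF tendsto_rabs[OF elim] c(1)]) (use inf True in auto)
  qed
  then have "AE z in restrict_space lborel unit_square. ereal \<bar>W z\<bar> \<le> ereal C"
    by (subst AE_restrict_space_iff) (auto simp: measurable_Times_borel elim!: eventually_mono)
  moreover have "(\<lambda>z. ereal \<bar>W z\<bar>) \<in> borel_measurable (restrict_space lborel unit_square)"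
    by (intro measurable_restrict_space1) simp
  ultimately show ?thesis unfolding Lp_norm_def using True by (simp add: esssup_I)
next
  case False
  define q where "q = real_of_ereal p"
  have q: "1 < q" using p False by (cases p) (auto simp: q_def)
  have "(\<integral>\<^sup>+z. ennreal (\<bar>W z\<bar> powr q) \<partial>lborel) \<le> ennreal (C powr q)"
  proof (rule nn_integral_powr_AE_limit_le[where f = f])
    show "(\<lambda>n. c n powr q) \<longlonglongrightarrow> C powr q"
      using q C by (intro tendsto_powr c(1) tendsto_const) auto
  qed (use conv q fin False in \<open>auto simp: q_def\<close>)
  moreover have "(\<integral>\<^sup>+z\<in>unit_square. ennreal (\<bar>W z\<bar> powr q) \<partial>lborel) \<le> (\<integral>\<^sup>+z. ennreal (\<bar>W z\<bar> powr q) \<partial>lborel)"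
    by (intro nn_integral_mono) (auto simp: indicator_def)
  ultimately have I: "(\<integral>\<^sup>+z\<in>unit_square. ennreal (\<bar>W z\<bar> powr q) \<partial>lborel) \<le> ennreal (C powr q)" by simp
  then have "enn2real (\<integral>\<^sup>+z\<in>unit_square. ennreal (\<bar>W z\<bar> powr q) \<partial>lborel) \<le> C powr q"
    by (intro enn2real_leI) auto
  then have "enn2real (\<integral>\<^sup>+z\<in>unit_square. ennreal (\<bar>W z\<bar> powr q) \<partial>lborel) powr (1 / q) \<le> (C powr q) powr (1 / q)"
    using q by (intro powr_mono2) auto
  also have "\<dots> = C" using q C by (simp add: powr_powr)
  finally show ?thesis
    unfolding Lp_norm_def Let_def q_def[symmetric] using False I
    by (auto simp: top_unique)
qed

theorem theorem2p8:
  fixes p :: ereal and C :: real and G :: "nat \<Rightarrow> 'v::linorder wgraph"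
  assumes "p > 1" and "C > 0"
    and "\<And>n. weighted_graph (G n)"
    and "\<And>n. norm1 (G n) \<noteq> 0"
    and "upper_Lp_regular_seq C p G"
  shows "\<exists>W. Lp_graphon p W \<and> Lp_norm p W \<le> ereal C \<and>
    liminf (\<lambda>n. graph_cut_dist (scale_graph (1 / norm1 (G n)) (G n)) W) = 0"
proof -
  \<comment> \<open>small enough to refine \<open>n\<close> times starting from the trivial partition\<close>
  define \<eta> where "\<eta> n = 1 / 16 ^ n / (32 :: real)" for n :: nat
  have \<eta>: "0 < \<eta> n" "\<eta> n \<le> 1" for n
    using one_le_power[of "16 :: real" n] by (auto simp: \<eta>_def divide_le_eq simp del: one_le_power)
  obtain \<rho> where \<rho>: "\<And>n. n \<le> \<rho> n" "\<And>n. upper_Lp_regular (C + \<eta> n) (\<eta> n) p (G (\<rho> n))"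
    by (rule ex_regular_subsequence[OF assms(5), of \<eta>]) (use \<eta>(1) in blast)+
  define H where "H n = G (\<rho> n)" for n
  have wg: "weighted_graph (H n)" and n1: "norm1 (H n) \<noteq> 0" for n
    using assms(3,4) by (auto simp: H_def)
  have reg: "upper_Lp_regular (C + \<eta> n) (\<eta> n) p (H n)" for n using \<rho> by (simp add: H_def)
  have ker: "kernel (verts (H n)) (nweight (H n)) (nedge (H n))" for n
    by (rule graph_kernel[OF wg n1])
  have small: "nweight (H n) i \<le> 1 / 16 ^ n / 32" if "i \<in> verts (H n)" for n i
    using reg[of n] that total_weight_pos[OF wg] unfolding upper_Lp_regular_def \<eta>_def[symmetric]
    by (simp add: divide_le_eq)
  define good where "good n \<kappa> \<longleftrightarrow> (\<forall>k<n. \<forall>i\<in>verts (H n). \<kappa> (Suc k) i div 4 = \<kappa> k i) \<and>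
    (\<forall>k\<le>n. (\<forall>i\<in>verts (H n). \<kappa> k i < 4 ^ k) \<and>
      (\<forall>a<4 ^ k. 1 / 16 ^ k \<le> sum (nweight (H n)) (kernel.block (verts (H n)) (\<kappa> k) a))) \<and>
    (\<forall>k<n. \<forall>S\<subseteq>verts (H n). \<forall>T\<subseteq>verts (H n). \<bar>\<Sum>i\<in>S. \<Sum>j\<in>T. nweight (H n) i * nweight (H n) j *
        (nedge (H n) i j - kernel.avg (verts (H n)) (nweight (H n)) (nedge (H n)) (\<kappa> k) (\<kappa> k i) (\<kappa> k j))\<bar>
       \<le> 36 * kernel.mean (verts (H n)) (nweight (H n)) (\<lambda>i j.
          \<bar>kernel.avg (verts (H n)) (nweight (H n)) (nedge (H n)) (\<kappa> (Suc k)) (\<kappa> (Suc k) i) (\<kappa> (Suc k) j)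
           - kernel.avg (verts (H n)) (nweight (H n)) (nedge (H n)) (\<kappa> k) (\<kappa> k i) (\<kappa> k j)\<bar>))"
    for n and \<kappa> :: "nat \<Rightarrow> 'v \<Rightarrow> nat"
  have "\<forall>n. \<exists>\<kappa>. good n \<kappa>"
    unfolding good_def by (intro allI kernel.refinement_chain[OF ker] small)
  from choice[OF this] obtain \<kappa> where \<kappa>: "\<And>n. good n (\<kappa> n)" by blast
  have "\<forall>n. \<exists>g :: 'v \<Rightarrow> nat. inj_on g (verts (H n)) \<and>
    (\<forall>i\<in>verts (H n). \<forall>j\<in>verts (H n). \<kappa> n n i < \<kappa> n n j \<longrightarrow> g i < g j)"
    using key_refining[OF kernel.finite_V[OF ker]] by metis
  from choice[OF this] obtain g :: "nat \<Rightarrow> 'v \<Rightarrow> nat" where g: "\<And>n. inj_on (g n) (verts (H n))"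
    "\<And>n i j. i \<in> verts (H n) \<Longrightarrow> j \<in> verts (H n) \<Longrightarrow> \<kappa> n n i < \<kappa> n n j \<Longrightarrow> g n i < g n j"
    by blast
  have lab: "\<kappa> n k i < 4 ^ k" if "k \<le> n" "i \<in> verts (H n)" for n k i
    using \<kappa>[of n] that unfolding good_def by blast
  have block: "1 / 16 ^ k \<le> sum (nweight (H n)) (kernel.block (verts (H n)) (\<kappa> n k) a)"
    if "k \<le> n" "a < 4 ^ k" for n k a
    using \<kappa>[of n] that unfolding good_def by blast
  \<comment> \<open>One regularity parameter serves all levels up to \<open>n\<close>, because it
    lies below the smallest guaranteed block weight \<open>1 / 16 ^ n\<close>.\<close>
  have large: "\<eta> n \<le> sum (nweight (H n)) (kernel.block (verts (H n)) (\<kappa> n k) (\<kappa> n k i))"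
    if "k \<le> n" "i \<in> verts (H n)" for n k i
  proof -
    have "\<eta> n \<le> 1 / 16 ^ n" by (simp add: \<eta>_def frac_le)
    also have "\<dots> \<le> 1 / 16 ^ k" using that by (intro divide_left_mono power_increasing) auto
    also have "\<dots> \<le> sum (nweight (H n)) (kernel.block (verts (H n)) (\<kappa> n k) (\<kappa> n k i))"
      by (rule block[OF that(1) lab[OF that]])
    finally show ?thesis .
  qed
  note avg_bound = regular_avg_bound[OF wg n1 reg large]
  \<comment> \<open>For uniform integrability any exponent above 1 will do when \<open>p = \<infinity>\<close>.\<close>
  define q where "q = (if p = \<infinity> then 2 else real_of_ereal p)"
  have q: "1 < q" using assms(1) by (cases p) (auto simp: q_def)
  have moment_le: "kernel.mean (verts (H n)) (nweight (H n)) (\<lambda>i j.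
      \<bar>kernel.avg (verts (H n)) (nweight (H n)) (nedge (H n)) (\<kappa> n k) (\<kappa> n k i) (\<kappa> n k j)\<bar> powr q)
      \<le> (C + \<eta> n) powr q" if "k \<le> n" for n k
  proof (cases "p = \<infinity>")
    case False
    then show ?thesis using avg_bound(1)[OF that] by (simp add: q_def)
  next
    case True
    interpret kernel "verts (H n)" "nweight (H n)" "nedge (H n)" by (rule ker)
    have "mean (\<lambda>i j. \<bar>av (\<kappa> n k) i j\<bar> powr q) \<le> mean (\<lambda>i j. (C + \<eta> n) powr q)"
      using avg_bound(2)[OF that _ True] q by (intro mean_mono powr_mono2) auto
    then show ?thesis by (simp add: mean_const)
  qed
  \<comment> \<open>By \<open>\<eta> n \<le> 1\<close> the moment bound does not depend on
    \<open>n\<close>.\<close>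
  interpret kernel_seq "\<lambda>n. verts (H n)" "\<lambda>n. nweight (H n)" "\<lambda>n. nedge (H n)" \<kappa> g q "(C + 1) powr q"
  proof (rule kernel_seq.intro)
    fix n k assume "k \<le> (n :: nat)"
    show "kernel.mean (verts (H n)) (nweight (H n)) (\<lambda>i j.
      \<bar>kernel.avg (verts (H n)) (nweight (H n)) (nedge (H n)) (\<kappa> n k) (\<kappa> n k i) (\<kappa> n k j)\<bar> powr q)
      \<le> (C + 1) powr q"
      by (rule order_trans[OF moment_le[OF \<open>k \<le> n\<close>] powr_mono2]) (use q assms(2) \<eta> in \<open>auto simp: less_imp_le\<close>)
  next
    fix n k i assume "k < (n :: nat)" "i \<in> verts (H n)"
    then show "\<kappa> n (Suc k) i div 4 = \<kappa> n k i" using \<kappa>[of n] unfolding good_def by blast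
  next
    show "kernel (verts (H n)) (nweight (H n)) (nedge (H n))" for n by (rule ker)
    show "\<kappa> n k i < 4 ^ k" if "k \<le> n" "i \<in> verts (H n)" for n k i by (rule lab[OF that])
    show "1 / 16 ^ k \<le> sum (nweight (H n)) (kernel.block (verts (H n)) (\<kappa> n k) a)"
      if "k \<le> n" "a < 4 ^ k" for n k a by (rule block[OF that])
    show "inj_on (g n) (verts (H n))" for n by (rule g(1))
    show "g n i < g n j" if "i \<in> verts (H n)" "j \<in> verts (H n)" "\<kappa> n n i < \<kappa> n n j" for n i j
      by (rule g(2)[OF that])
    show "1 < q" by (rule q)
  qed
  obtain \<phi> k W where W: "\<And>j. j \<le> \<phi> j" "\<And>j. k j < \<phi> j" "integrable lborel W"
    "\<And>x y. W (x, y) = W (y, x)"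
    "AE z in lborel. (\<lambda>j. U (\<phi> j) (k j) z) \<longlonglongrightarrow> W z"
    "(\<lambda>j. LINT z|lborel. \<bar>U (\<phi> j) (k j) z - W z\<bar>) \<longlonglongrightarrow> 0"
    "(\<lambda>j. LINT z|lborel. \<bar>U (\<phi> j) (Suc (k j)) z - U (\<phi> j) (k j) z\<bar>) \<longlonglongrightarrow> 0"
    by (rule diagonal_limit) blast
  \<comment> \<open>The uniform bound with \<open>C + 1\<close> is too weak here. The individual
    bounds \<open>C + \<eta> (\<phi> j)\<close> are used, which tend to \<open>C\<close>.\<close>
  have norm_le: "Lp_norm p W \<le> ereal C"
  proof (rule Lp_norm_AE_limit_le[OF assms(1,2) U_measurable _ W(5)])
    show "W \<in> borel_measurable borel" using W(3) by auto
    have "(\<lambda>n. (1 / 16 :: real) ^ n / 32) \<longlonglongrightarrow> 0 / 32"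
      by (intro tendsto_intros LIMSEQ_power_zero) auto
    then have "\<eta> \<longlonglongrightarrow> 0" by (simp add: \<eta>_def[abs_def] power_one_over)
    moreover have "filterlim \<phi> sequentially sequentially"
      by (rule filterlim_at_top_mono[OF filterlim_ident]) (simp add: W(1))
    ultimately have "(\<lambda>j. \<eta> (\<phi> j)) \<longlonglongrightarrow> 0" by (rule filterlim_compose)
    then have "(\<lambda>j. C + \<eta> (\<phi> j)) \<longlonglongrightarrow> C + 0" by (intro tendsto_intros)
    then show "(\<lambda>j. C + \<eta> (\<phi> j)) \<longlonglongrightarrow> C" by simp
    show "0 \<le> C + \<eta> (\<phi> j)" for j using assms(2) \<eta>(1)[of "\<phi> j"] by simp
  next
    fix j assume "p \<noteq> \<infinity>"
    then have qp: "real_of_ereal p = q" by (simp add: q_def)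
    have kj: "k j \<le> \<phi> j" using W(2)[of j] by simp
    interpret K: kernel "verts (H (\<phi> j))" "nweight (H (\<phi> j))" "nedge (H (\<phi> j))" by (rule ker)
    have I: "has_bochner_integral lborel (\<lambda>z. \<bar>U (\<phi> j) (k j) z\<bar> powr q)
      (K.mean (\<lambda>i i'. \<bar>d (\<phi> j) (k j) (\<kappa> (\<phi> j) (k j) i) (\<kappa> (\<phi> j) (k j) i')\<bar> powr q))"
      unfolding U_def by (rule K.integral_step[OF tile, where h = "\<lambda>x y. \<bar>x\<bar> powr q"]) simp
    have "(\<integral>\<^sup>+z. ennreal (\<bar>U (\<phi> j) (k j) z\<bar> powr q) \<partial>lborel) = ennreal
      (K.mean (\<lambda>i i'. \<bar>d (\<phi> j) (k j) (\<kappa> (\<phi> j) (k j) i) (\<kappa> (\<phi> j) (k j) i')\<bar> powr q))"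
      using I by (subst nn_integral_eq_integral) (auto simp: has_bochner_integral_iff)
    also have "\<dots> \<le> ennreal ((C + \<eta> (\<phi> j)) powr q)"
      unfolding d_def by (intro ennreal_leI moment_le kj)
    finally show "(\<integral>\<^sup>+z. ennreal (\<bar>U (\<phi> j) (k j) z\<bar> powr real_of_ereal p) \<partial>lborel)
      \<le> ennreal ((C + \<eta> (\<phi> j)) powr real_of_ereal p)" by (simp add: qp)
  next
    fix j and z :: "real \<times> real" assume pinf: "p = \<infinity>"
    obtain x y where z: "z = (x, y)" by (cases z)
    have kj: "k j \<le> \<phi> j" using W(2)[of j] by simp
    show "\<bar>U (\<phi> j) (k j) z\<bar> \<le> C + \<eta> (\<phi> j)"
    proof (cases "x \<in> {0..<1} \<and> y \<in> {0..<1}")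
      case True
      then have xy: "0 \<le> x" "x < 1" "0 \<le> y" "y < 1" by auto
      obtain i where i: "i \<in> verts (H (\<phi> j))" "x \<in> J (\<phi> j) i"
        by (rule tiling_cell[OF tile xy(1,2)])
      obtain i' where i': "i' \<in> verts (H (\<phi> j))" "y \<in> J (\<phi> j) i'"
        by (rule tiling_cell[OF tile xy(3,4)])
      show ?thesis
        unfolding z U_cell[OF i(1) i'(1) i(2) i'(2)] unfolding d_def
        by (rule avg_bound(2)[OF kj _ pinf i(1) i'(1)])
    next
      case False
      then show ?thesis using U_outside[of x y] assms(2) \<eta>(1)[of "\<phi> j"] by (simp add: z)
    qed
  qed
  have "set_integrable lborel unit_square W"
    unfolding set_integrable_def
    by (rule integrable_mult_indicator[OF _ W(3)]) (simp add: measurable_Times_borel)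
  then have graphon: "graphon W" unfolding graphon_def using W(4) by blast
  have liminf_0: "liminf (\<lambda>n. graph_cut_dist (scale_graph (1 / norm1 (G n)) (G n)) W) = 0"
  proof (rule antisym)
    \<comment> \<open>The first term bounds the cut discrepancy between graph and block average, the
      second the L1 distance from block average to limit.\<close>
    define c where "c j = 36 * (LINT z|lborel. \<bar>U (\<phi> j) (Suc (k j)) z - U (\<phi> j) (k j) z\<bar>)
      + (LINT z|lborel. \<bar>U (\<phi> j) (k j) z - W z\<bar>)" for j
    have "c \<longlonglongrightarrow> 36 * 0 + 0" unfolding c_def[abs_def] by (intro tendsto_intros W(6,7))
    then have c0: "c \<longlonglongrightarrow> 0" by simp
    have le: "graph_cut_dist (scale_graph (1 / norm1 (H (\<phi> j))) (H (\<phi> j))) W \<le> ereal (c j)" for j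
      unfolding c_def U_def[of "\<phi> j" "k j", abs_def]
    proof (rule graph_cut_dist_le[OF wg n1 tile _ W(3)])
      fix S T assume ST: "S \<subseteq> verts (H (\<phi> j))" "T \<subseteq> verts (H (\<phi> j))"
      show "\<bar>\<Sum>i\<in>S. \<Sum>i'\<in>T. nweight (H (\<phi> j)) i * nweight (H (\<phi> j)) i' *
          (nedge (H (\<phi> j)) i i' - d (\<phi> j) (k j) (\<kappa> (\<phi> j) (k j) i) (\<kappa> (\<phi> j) (k j) i'))\<bar>
        \<le> 36 * (LINT z|lborel. \<bar>U (\<phi> j) (Suc (k j)) z -
            step (verts (H (\<phi> j))) (J (\<phi> j)) (\<lambda>i i'. d (\<phi> j) (k j) (\<kappa> (\<phi> j) (k j) i) (\<kappa> (\<phi> j) (k j) i')) z\<bar>)"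
        unfolding U_def[of "\<phi> j" "k j", symmetric] has_bochner_integral_integral_eq[OF U_dist]
        unfolding d_def using \<kappa>[of "\<phi> j"] W(2)[of j] ST unfolding good_def by blast
    qed
    show "liminf (\<lambda>n. graph_cut_dist (scale_graph (1 / norm1 (G n)) (G n)) W) \<le> 0"
      unfolding liminf_SUP_INF
    proof (rule SUP_least)
      fix n
      \<comment> \<open>The graph \<open>H (\<phi> j)\<close> is
        \<open>G (\<rho> (\<phi> j))\<close>, whose index is at least \<open>j\<close> and hence in
        the tail from \<open>n\<close> on.\<close>
      have le_c: "(INF m\<in>{n..}. graph_cut_dist (scale_graph (1 / norm1 (G m)) (G m)) W) \<le> ereal (c j)"
        if "n \<le> j" for j
      proof (rule INF_lower2)
        show "\<rho> (\<phi> j) \<in> {n..}" using that W(1)[of j] \<rho>(1)[of "\<phi> j"] by simp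
        show "graph_cut_dist (scale_graph (1 / norm1 (G (\<rho> (\<phi> j)))) (G (\<rho> (\<phi> j)))) W \<le> ereal (c j)"
          using le[of j] by (simp add: H_def)
      qed
      have "(\<lambda>j. ereal (c j)) \<longlonglongrightarrow> 0" using c0 by (simp add: zero_ereal_def)
      then show "(INF m\<in>{n..}. graph_cut_dist (scale_graph (1 / norm1 (G m)) (G m)) W) \<le> 0"
        by (rule LIMSEQ_le_const) (use le_c in blast)
    qed
    show "0 \<le> liminf (\<lambda>n. graph_cut_dist (scale_graph (1 / norm1 (G n)) (G n)) W)"
      by (intro Liminf_bounded always_eventually allI graph_cut_dist_nonneg)
  qed
  have "Lp_norm p W < \<infinity>" by (rule le_less_trans[OF norm_le]) simp
  with graphon norm_le liminf_0 show ?thesis unfolding Lp_graphon_def by blast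
qed

end
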